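(* Let $\mathcal R$ be a ring. Then $NK_1(\mathcal R)=0$ if and only if for all square matrices $A,B$ over $\mathcal R$: $A$ and $B$ are shift equivalent over $\mathcal R$ if and only if $A$ and $B$ are strong shift equivalent over $\mathcal R$.
   Context: For a ring $\mathcal R$ (with $1$), $GL(\mathcal R)=\varinjlim GL_n(\mathcal R)$ under $A\mapsto\begin{pmatrix}A&0\\0&1\end{pmatrix}$, $El(\mathcal R)$ is the subgroup generated by elementary matrices (matrices equal to the identity except in at most one off-diagonal entry), and $K_1(\mathcal R)=GL(\mathcal R)/El(\mathcal R)$. $NK_1(\mathcal R)$ is the kernel of the homomorphism $K_1(\mathcal R[t])\to K_1(\mathcal R)$ induced by $t\mapsto 0$. Square matrices $A,B$ over $\mathcal R$ (possibly of different sizes) are elementary strong shift equivalent over $\mathcal R$ if there are matrices $R,S$ over $\mathcal R$ with $A=RS$, $B=SR$; strong shift equivalence over $\mathcal R$ is the transitive closure of this relation. They are shift equivalent over $\mathcal R$ if there are matrices $R,S$ over $\mathcal R$ and a positive integer $\ell$ with $A^{\ell}=RS$, $B^{\ell}=SR$, $AR=RB$, $SA=BS$. *)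

theory Defs
  imports
    "Jordan_Normal_Form.Matrix"
    "HOL-Library.Poly_Mapping"
    "HOL-Algebra.Generated_Groups"
    "HOL-Algebra.Elementary_Groups"
begin

text \<open>
  Rings with 1, neither assumed commutative nor nontrivial, are types of sort
  \<open>{ring, monoid_mult}\<close>: the class \<open>ring_1\<close> would exclude the zero ring. This is also the
  reason why the power and the invertibility of matrices, which the library provides only
  over \<open>semiring_1\<close>, are restated here.
\<close>

section \<open>The polynomial ring in one central indeterminate\<close>

text \<open>
  The type of univariate polynomials has a product only over commutative coefficients.
  Poly_Mapping supplies the convolution product over arbitrary rings on the type of finitely
  supported functions from the exponents to the coefficients, but a unit element only if
  \<open>0 \<noteq> 1\<close>. The type below is a copy of it with the unit element \<open>single 0 1\<close>.
\<close>

typedef (overloaded) 'a npoly = "UNIV :: (nat \<Rightarrow>\<^sub>0 'a::zero) set"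
  by simp

setup_lifting type_definition_npoly

instantiation npoly :: (ring) ring
begin

lift_definition zero_npoly :: "'a npoly" is 0 .
lift_definition plus_npoly :: "'a npoly \<Rightarrow> 'a npoly \<Rightarrow> 'a npoly" is "(+)" .
lift_definition uminus_npoly :: "'a npoly \<Rightarrow> 'a npoly" is uminus .
lift_definition minus_npoly :: "'a npoly \<Rightarrow> 'a npoly \<Rightarrow> 'a npoly" is "(-)" .
lift_definition times_npoly :: "'a npoly \<Rightarrow> 'a npoly \<Rightarrow> 'a npoly" is "(*)" .

instance
  by standard (transfer; simp add: algebra_simps)+

end

instantiation npoly :: ("{ring, monoid_mult}") monoid_mult
begin

lift_definition one_npoly :: "'a npoly" is "Poly_Mapping.single 0 1" .

instance
proof
  fix p :: "'a npoly"
  have l: "Poly_Mapping.single 0 1 * q = q" for q :: "nat \<Rightarrow>\<^sub>0 'a"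
    by transfer (simp add: prod_fun_def [abs_def] when_mult)
  have r: "q * Poly_Mapping.single 0 1 = q" for q :: "nat \<Rightarrow>\<^sub>0 'a"
    apply transfer
    apply (simp add: prod_fun_def [abs_def] Sum_any_right_distrib mult_when)
    apply (subst when_commute)
    apply simp
    done
  show "1 * p = p" by transfer (rule l)
  show "p * 1 = p" by transfer (rule r)
qed

end

lift_definition npoly_coeff :: "'a::zero npoly \<Rightarrow> nat \<Rightarrow> 'a" is Poly_Mapping.lookup .

lemma npoly_eqI: "(\<And>n. npoly_coeff p n = npoly_coeff q n) \<Longrightarrow> p = q"
  by transfer (rule poly_mapping_eqI)

lemma npoly_coeff_add: "npoly_coeff (p + q) n = npoly_coeff p n + npoly_coeff q n"
  by transfer (rule lookup_add)

lemma npoly_coeff_one: "npoly_coeff (1 :: 'a::{ring, monoid_mult} npoly) n = (if n = 0 then 1 else 0)"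
  by transfer (simp add: lookup_single when_def)

lemma npoly_coeff_mult:
  fixes p q :: "'a::ring npoly"
  shows "npoly_coeff (p * q) n = (\<Sum>i\<le>n. npoly_coeff p i * npoly_coeff q (n - i))"
proof transfer
  fix p q :: "nat \<Rightarrow>\<^sub>0 'a" and n
  have inner: "Sum_any (\<lambda>j. Poly_Mapping.lookup q j when n = i + j)
      = (if i \<le> n then Poly_Mapping.lookup q (n - i) else 0)" for i
  proof (cases "i \<le> n")
    case True
    then have "Sum_any (\<lambda>j. Poly_Mapping.lookup q j when n = i + j)
        = Sum_any (\<lambda>j. Poly_Mapping.lookup q j when j = n - i)"
      by (intro arg_cong [where f = Sum_any]) (auto simp: when_def fun_eq_iff)
    also have "\<dots> = Poly_Mapping.lookup q (n - i)"
      by simp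
    finally show ?thesis
      using True by simp
  next
    case False
    then show ?thesis by (auto simp: when_def)
  qed
  have "Poly_Mapping.lookup (p * q) n =
      Sum_any (\<lambda>i. Poly_Mapping.lookup p i * (if i \<le> n then Poly_Mapping.lookup q (n - i) else 0))"
    by (simp add: times_poly_mapping.rep_eq prod_fun_def inner)
  also have "\<dots> = (\<Sum>i\<le>n. Poly_Mapping.lookup p i *
      (if i \<le> n then Poly_Mapping.lookup q (n - i) else 0))"
    by (rule Sum_any.expand_superset) (auto split: if_splits)
  finally show "Poly_Mapping.lookup (p * q) n =
      (\<Sum>i\<le>n. Poly_Mapping.lookup p i * Poly_Mapping.lookup q (n - i))"
    by simp
qed

text \<open>The homomorphism \<open>t \<mapsto> 0\<close> is the constant coefficient.\<close>

definition npoly_at_0 :: "'a::zero npoly \<Rightarrow> 'a"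
  where "npoly_at_0 p = npoly_coeff p 0"

lemma npoly_at_0_hom:
  fixes p q :: "'a::{ring, monoid_mult} npoly"
  shows "npoly_at_0 (p + q) = npoly_at_0 p + npoly_at_0 q"
    and "npoly_at_0 (p * q) = npoly_at_0 p * npoly_at_0 q"
    and "npoly_at_0 (1 :: 'a npoly) = 1"
  by (simp_all add: npoly_at_0_def npoly_coeff_add npoly_coeff_mult npoly_coeff_one)


section \<open>The groups \<open>GL\<close>, \<open>El\<close>, \<open>K\<^sub>1\<close> and \<open>NK\<^sub>1\<close>\<close>

definition invertible_square :: "'r::{ring, monoid_mult} mat \<Rightarrow> bool"
  where "invertible_square A \<longleftrightarrow>
    (\<exists>n. A \<in> carrier_mat n n \<and> (\<exists>B \<in> carrier_mat n n. A * B = 1\<^sub>m n \<and> B * A = 1\<^sub>m n))"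

definition stabilize :: "nat \<Rightarrow> 'r::{ring, monoid_mult} mat \<Rightarrow> 'r mat"
  where "stabilize k A =
    four_block_mat A (0\<^sub>m (dim_row A) k) (0\<^sub>m k (dim_col A)) (1\<^sub>m k)"

text \<open>
  The direct limit of the \<open>GL\<^sub>n\<close> is the disjoint union of the \<open>GL\<^sub>n\<close> (a matrix knows its
  size) modulo the relation of becoming equal in some \<open>GL\<^sub>n\<close>. The product of two classes is
  the class of the product of representatives of equal size.
\<close>

definition stably_equal :: "('r::{ring, monoid_mult} mat \<times> 'r mat) set"
  where "stably_equal = {(A, B). invertible_square A \<and> invertible_square B \<and>
    (\<exists>k l. stabilize k A = stabilize l B)}"

definition stable_class :: "'r::{ring, monoid_mult} mat \<Rightarrow> 'r mat set"
  where "stable_class A = stably_equal `` {A}"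

definition GL :: "'r::{ring, monoid_mult} itself \<Rightarrow> 'r mat set monoid"
  where "GL _ = \<lparr>carrier = Collect invertible_square // stably_equal,
    mult = (\<lambda>X Y. \<Union>{stable_class (A * B) |A B. A \<in> X \<and> B \<in> Y \<and> dim_row A = dim_row B}),
    one = stable_class (1\<^sub>m 1)\<rparr>"

definition elementary_matrix :: "'r::{ring, monoid_mult} mat \<Rightarrow> bool"
  where "elementary_matrix E \<longleftrightarrow> square_mat E \<and>
    (\<exists>i j. i \<noteq> j \<and> (\<forall>k < dim_row E. \<forall>l < dim_row E.
       (k, l) \<noteq> (i, j) \<longrightarrow> E $$ (k, l) = 1\<^sub>m (dim_row E) $$ (k, l)))"

definition El :: "'r::{ring, monoid_mult} itself \<Rightarrow> 'r mat set set"
  where "El T = generate (GL T) (stable_class ` Collect elementary_matrix)"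

definition K1 :: "'r::{ring, monoid_mult} itself \<Rightarrow> 'r mat set set monoid"
  where "K1 T = GL T Mod El T"

text \<open>
  For a ring homomorphism \<open>f\<close>, the maps induced on \<open>GL\<close> and on \<open>K\<^sub>1\<close>. The unions only
  combine equal sets: the class (coset) of the image of a representative does not depend
  on the representative.
\<close>

definition GL_map :: "('r::{ring, monoid_mult} \<Rightarrow> 's::{ring, monoid_mult}) \<Rightarrow> 'r mat set \<Rightarrow> 's mat set"
  where "GL_map f X = (\<Union>A\<in>X. stable_class (map_mat f A))"

definition K1_map :: "('r::{ring, monoid_mult} \<Rightarrow> 's::{ring, monoid_mult}) \<Rightarrow> 'r mat set set \<Rightarrow> 's mat set set"
  where "K1_map f C = (\<Union>X\<in>C. El TYPE('s) #>\<^bsub>GL TYPE('s)\<^esub> GL_map f X)"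

definition NK1 :: "'r::{ring, monoid_mult} itself \<Rightarrow> 'r npoly mat set set monoid"
  where "NK1 _ = (K1 TYPE('r npoly))
    \<lparr>carrier := kernel (K1 TYPE('r npoly)) (K1 TYPE('r)) (K1_map npoly_at_0)\<rparr>"


section \<open>Shift equivalence and strong shift equivalence\<close>

text \<open>Matrices without rows or columns are excluded throughout.\<close>

primrec mat_power :: "'r::{ring, monoid_mult} mat \<Rightarrow> nat \<Rightarrow> 'r mat"
  where
    "mat_power A 0 = 1\<^sub>m (dim_row A)"
  | "mat_power A (Suc l) = mat_power A l * A"

definition elementary_strong_shift_equivalent :: "'r::{ring, monoid_mult} mat \<Rightarrow> 'r mat \<Rightarrow> bool"
  where "elementary_strong_shift_equivalent A B \<longleftrightarrow>
    (\<exists>m n. 0 < m \<and> 0 < n \<and>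
      (\<exists>R \<in> carrier_mat m n. \<exists>S \<in> carrier_mat n m. A = R * S \<and> B = S * R))"

definition strong_shift_equivalent :: "'r::{ring, monoid_mult} mat \<Rightarrow> 'r mat \<Rightarrow> bool"
  where "strong_shift_equivalent = elementary_strong_shift_equivalent\<^sup>+\<^sup>+"

definition shift_equivalent :: "'r::{ring, monoid_mult} mat \<Rightarrow> 'r mat \<Rightarrow> bool"
  where "shift_equivalent A B \<longleftrightarrow>
    (\<exists>m n. 0 < m \<and> 0 < n \<and> A \<in> carrier_mat m m \<and> B \<in> carrier_mat n n \<and>
      (\<exists>R \<in> carrier_mat m n. \<exists>S \<in> carrier_mat n m. \<exists>l > 0.
         mat_power A l = R * S \<and> mat_power B l = S * R \<and> A * R = R * B \<and> S * A = B * S))"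

end

theory Submission
  imports Defs "HOL-Combinatorics.Transposition" "HOL-Library.Nat_Bijection"
begin

text \<open>
  A shift equivalence makes \<open>1 - tA\<close> and \<open>1 - tB\<close> stably equivalent by explicit invertible matrices
  over \<open>R[t]\<close> that are elementary at \<open>t = 0\<close>, hence elementary if \<open>NK\<^sub>1(R) = 0\<close>. The elementary
  group of \<open>R[t]\<close> is generated by the transvections \<open>1 + X\<close> and \<open>1 + tX\<close> with \<open>X\<close> a multiple of an
  off-diagonal matrix unit, and multiplying a polynomial matrix \<open>1 - M\<close> by one of them on either
  side does not change the strong shift equivalence class of the companion matrix of \<open>M\<close>. So \<open>A\<close>
  and \<open>B\<close> are strong shift equivalent. Conversely, Higman's trick reduces a class of \<open>NK\<^sub>1(R)\<close> to
  some \<open>1 - tN\<close> with \<open>N\<close> nilpotent, that is, shift equivalent to \<open>0\<close>; and a strong shift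
  equivalence from \<open>N\<close> to \<open>0\<close> makes \<open>1 - tN\<close> elementary.
\<close>

section \<open>Finitely supported matrices\<close>

text \<open>The obstacle is that the recursion behind a companion matrix absorbs only factors of
  degree at most one in \<open>t\<close>. Transvections with an arbitrary polynomial entry are
  reached through the Steinberg commutator formula, which takes three distinct indices. A constant
  factor spoils the constant coefficient 1 of \<open>1 - M\<close>, so the invariant
  \<open>Phi\<close> allows any invertible constant coefficient and divides it out. Elementary
  equivalence is a stable notion and sizes change all the time; stabilization becomes invisible once
  the matrix \<open>1 + u\<close> is represented by its finitely supported part \<open>u\<close>.
  The price is the missing unit: products turn into \<open>circ\<close>, powers start with exponent
  one, and the idempotents \<open>idm n\<close> act as identity matrices wherever a size is
  fixed.\<close>

text \<open>Padding by zeros makes all square matrices elements of one ring without unit; it does not affect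
  strong shift equivalence.\<close>

typedef (overloaded) 'a fmat =
    "{f :: nat \<Rightarrow> nat \<Rightarrow> 'a::zero. \<exists>n. \<forall>i j. n \<le> i \<or> n \<le> j \<longrightarrow> f i j = 0}"
  morphisms ent Abs_fmat
  by (rule exI [of _ "\<lambda>_ _. 0"]) simp

setup_lifting type_definition_fmat

lemma fmat_eqI: "(\<And>i j. ent a i j = ent b i j) \<Longrightarrow> a = b"
  by transfer (simp add: fun_eq_iff)

definition bounded_by :: "nat \<Rightarrow> 'a::zero fmat \<Rightarrow> bool"
  where "bounded_by n a \<longleftrightarrow> (\<forall>i j. n \<le> i \<or> n \<le> j \<longrightarrow> ent a i j = 0)"

lemma bounded_by_ex: "\<exists>n. bounded_by n a"
  unfolding bounded_by_def by transfer

lemma bounded_by_mono: "bounded_by m a \<Longrightarrow> m \<le> n \<Longrightarrow> bounded_by n a"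
  unfolding bounded_by_def by (meson order.trans)

lemma bounded_byD:
  assumes "bounded_by n a" "n \<le> i \<or> n \<le> j"
  shows "ent a i j = 0"
  using assms unfolding bounded_by_def by blast

lemma bounded_by_max:
  "bounded_by m a \<Longrightarrow> bounded_by (max m n) a" "bounded_by n a \<Longrightarrow> bounded_by (max m n) a"
  by (auto elim: bounded_by_mono)

lemma bounded_by_ex2: "\<exists>n. bounded_by n a \<and> bounded_by n b"
  using bounded_by_ex [of a] bounded_by_ex [of b] by (meson bounded_by_max)

lemma bounded_by_ex3: "\<exists>n. bounded_by n a \<and> bounded_by n b \<and> bounded_by n c"
  using bounded_by_ex2 [of a b] bounded_by_ex [of c] by (meson bounded_by_max)

lift_definition fm :: "nat \<Rightarrow> (nat \<Rightarrow> nat \<Rightarrow> 'a::zero) \<Rightarrow> 'a fmat"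
  is "\<lambda>n f i j. if i < n \<and> j < n then f i j else 0"
  by (metis not_less)

lemma ent_fm: "ent (fm n f) i j = (if i < n \<and> j < n then f i j else 0)"
  by transfer simp

lemma bounded_by_fm: "bounded_by n (fm n f)"
  by (auto simp: bounded_by_def ent_fm)

instantiation fmat :: (ring) ring
begin

lift_definition zero_fmat :: "'a fmat" is "\<lambda>_ _. 0" by simp
lift_definition plus_fmat :: "'a fmat \<Rightarrow> 'a fmat \<Rightarrow> 'a fmat" is "\<lambda>f g i j. f i j + g i j"
  by (metis add.right_neutral linorder_le_cases order.trans)
lift_definition uminus_fmat :: "'a fmat \<Rightarrow> 'a fmat" is "\<lambda>f i j. - f i j"
  by simp
lift_definition minus_fmat :: "'a fmat \<Rightarrow> 'a fmat \<Rightarrow> 'a fmat" is "\<lambda>f g i j. f i j - g i j"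
  by (metis diff_zero linorder_le_cases order.trans)
text \<open>The index set, where both factors are nonzero, is finite by boundedness, so the product
  refers to no chosen bound.\<close>

lift_definition times_fmat :: "'a fmat \<Rightarrow> 'a fmat \<Rightarrow> 'a fmat"
  is "\<lambda>f g i j. \<Sum>k | f i k \<noteq> 0 \<and> g k j \<noteq> 0. f i k * g k j"
proof -
  fix f g :: "nat \<Rightarrow> nat \<Rightarrow> 'a"
  assume "\<exists>n. \<forall>i j. n \<le> i \<or> n \<le> j \<longrightarrow> f i j = 0" "\<exists>n. \<forall>i j. n \<le> i \<or> n \<le> j \<longrightarrow> g i j = 0"
  then obtain m n where "\<forall>i j. m \<le> i \<or> m \<le> j \<longrightarrow> f i j = 0" "\<forall>i j. n \<le> i \<or> n \<le> j \<longrightarrow> g i j = 0"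
    by blast
  then have "\<forall>i j. max m n \<le> i \<or> max m n \<le> j \<longrightarrow>
      (\<Sum>k | f i k \<noteq> 0 \<and> g k j \<noteq> 0. f i k * g k j) = 0"
    by (auto intro!: sum.neutral)
  then show "\<exists>n. \<forall>i j. n \<le> i \<or> n \<le> j \<longrightarrow> (\<Sum>k | f i k \<noteq> 0 \<and> g k j \<noteq> 0. f i k * g k j) = 0"
    by blast
qed

lemma ent_zero: "ent 0 i j = 0"
  by transfer simp
lemma ent_add: "ent (a + b) i j = ent a i j + ent b i j"
  by transfer simp
lemma ent_minus: "ent (- a) i j = - ent a i j"
  by transfer simp
lemma ent_diff: "ent (a - b) i j = ent a i j - ent b i j"
  by transfer simp

lemma ent_mult_on:
  assumes "finite K" "\<And>k. k \<notin> K \<Longrightarrow> ent a i k = 0 \<or> ent b k j = 0"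
  shows "ent (a * b) i j = (\<Sum>k\<in>K. ent a i k * ent b k j)"
proof -
  have "ent (a * b) i j = (\<Sum>k | ent a i k \<noteq> 0 \<and> ent b k j \<noteq> 0. ent a i k * ent b k j)"
    by transfer simp
  also have "\<dots> = (\<Sum>k\<in>K. ent a i k * ent b k j)"
    using assms by (intro sum.mono_neutral_left) auto
  finally show ?thesis .
qed

lemma ent_mult:
  assumes "bounded_by n a \<or> bounded_by n b"
  shows "ent (a * b) i j = (\<Sum>k<n. ent a i k * ent b k j)"
  using assms by (intro ent_mult_on) (auto simp: bounded_byD)

lemma bounded_by_mult:
  assumes "bounded_by n a" "bounded_by n b"
  shows "bounded_by n (a * b)"
  unfolding bounded_by_def
  using assms by (auto simp: ent_mult [of n] bounded_byD)

instance
proof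
  fix a b c :: "'a fmat"
  obtain n where n: "bounded_by n a" "bounded_by n b" "bounded_by n c"
    using bounded_by_ex3 by blast
  show "a * b * c = a * (b * c)"
  proof (rule fmat_eqI)
    fix i j
    have "ent (a * b * c) i j = (\<Sum>l<n. (\<Sum>k<n. ent a i k * ent b k l) * ent c l j)"
      using n by (simp add: ent_mult [of n] bounded_by_mult)
    also have "\<dots> = (\<Sum>k<n. \<Sum>l<n. ent a i k * ent b k l * ent c l j)"
      unfolding sum_distrib_right by (rule sum.swap)
    also have "\<dots> = ent (a * (b * c)) i j"
      using n by (simp add: ent_mult [of n] bounded_by_mult sum_distrib_left mult.assoc)
    finally show "ent (a * b * c) i j = ent (a * (b * c)) i j" .
  qed
  show "(a + b) * c = a * c + b * c"
    using n by (intro fmat_eqI) (simp add: ent_mult [of n] ent_add distrib_right sum.distrib)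
  show "a * (b + c) = a * b + a * c"
    using n by (intro fmat_eqI) (simp add: ent_mult [of n] ent_add distrib_left sum.distrib)
qed (transfer; simp add: algebra_simps)+

end

lemmas ent_simps = ent_zero ent_add ent_minus ent_diff ent_fm

lemma bounded_by_zero: "bounded_by n 0"
  by (simp add: bounded_by_def ent_zero)

lemma bounded_by_add: "bounded_by n a \<Longrightarrow> bounded_by n b \<Longrightarrow> bounded_by n (a + b)"
  by (simp add: bounded_by_def ent_add)

lemma bounded_by_minus: "bounded_by n a \<Longrightarrow> bounded_by n (- a)"
  by (simp add: bounded_by_def ent_minus)

lemma bounded_by_diff: "bounded_by n a \<Longrightarrow> bounded_by n b \<Longrightarrow> bounded_by n (a - b)"
  by (simp add: bounded_by_def ent_diff)

lemmas bounded_by_intros = bounded_by_zero bounded_by_add bounded_by_minus bounded_by_diff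
  bounded_by_mult

section \<open>Matrix units, partial identities and entrywise maps\<close>

definition sg :: "nat \<Rightarrow> nat \<Rightarrow> 'a::zero \<Rightarrow> 'a fmat"
  where "sg i j x = fm (Suc (max i j)) (\<lambda>k l. if k = i \<and> l = j then x else 0)"

lemma ent_sg: "ent (sg i j x) k l = (if k = i \<and> l = j then x else 0)"
  by (auto simp: sg_def ent_fm)

lemma bounded_by_sg: "i < n \<Longrightarrow> j < n \<Longrightarrow> bounded_by n (sg i j x)"
  by (auto simp: bounded_by_def ent_sg)

lemma sg_mult_sg: "sg i j (x::'a::ring) * sg k l y = (if j = k then sg i l (x * y) else 0)"
  by (rule fmat_eqI, subst ent_mult_on [of "{j}"]) (auto simp: ent_sg ent_zero)

lemma sg_add: "sg i j ((x::'a::ring) + y) = sg i j x + sg i j y"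
  by (rule fmat_eqI) (auto simp: ent_sg ent_add)

lemma sg_minus: "sg i j (- (x::'a::ring)) = - sg i j x"
  by (rule fmat_eqI) (auto simp: ent_sg ent_minus)

lemma sg_zero: "sg i j (0::'a::ring) = 0"
  by (rule fmat_eqI) (auto simp: ent_sg ent_zero)

definition idm :: "nat \<Rightarrow> 'a::{ring, monoid_mult} fmat"
  where "idm n = fm n (\<lambda>i j. if i = j then 1 else 0)"

lemma ent_idm: "ent (idm n) i j = (if i = j \<and> i < n then 1 else 0)"
  by (auto simp: idm_def ent_fm)

lemma bounded_by_idm: "bounded_by n (idm n)"
  by (simp add: idm_def bounded_by_fm)

lemma idm_mult:
  assumes "\<And>i j. n \<le> i \<Longrightarrow> ent a i j = 0"
  shows "idm n * a = a"
proof (rule fmat_eqI)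
  show "ent (idm n * a) i j = ent a i j" for i j
    using assms by (subst ent_mult_on [where K = "{i}"]) (auto simp: ent_idm)
qed

lemma mult_idm:
  assumes "\<And>i j. n \<le> j \<Longrightarrow> ent a i j = 0"
  shows "a * idm n = a"
proof (rule fmat_eqI)
  show "ent (a * idm n) i j = ent a i j" for i j
    using assms by (subst ent_mult_on [where K = "{j}"]) (auto simp: ent_idm)
qed

lemma idm_units:
  assumes "bounded_by n a"
  shows "idm n * a = a" "a * idm n = a"
  using assms by (auto intro!: idm_mult mult_idm dest: bounded_byD)

text \<open>Zero entries are kept whatever \<open>h\<close> does, which makes the support finite for
  every \<open>h\<close>.\<close>

lift_definition fmap :: "('a::zero \<Rightarrow> 'b::zero) \<Rightarrow> 'a fmat \<Rightarrow> 'b fmat"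
  is "\<lambda>h f i j. if f i j = 0 then 0 else h (f i j)"
  by metis

lemma ent_fmap: "h 0 = 0 \<Longrightarrow> ent (fmap h a) i j = h (ent a i j)"
  by transfer simp

lemma bounded_by_fmap: "h 0 = 0 \<Longrightarrow> bounded_by n a \<Longrightarrow> bounded_by n (fmap h a)"
  by (simp add: bounded_by_def ent_fmap)

lemma fmap_sg: "h 0 = 0 \<Longrightarrow> fmap h (sg i j x) = sg i j (h x)"
  by (rule fmat_eqI) (simp add: ent_fmap ent_sg)

text \<open>A matrix of matrices read as one matrix, with block index and inner index paired into
  one number. As it respects sums and products, companion matrices and 2 by 2 block matrices can be
  handled with matrices as entries and flattened afterwards.\<close>

definition flat :: "'a::ring fmat fmat \<Rightarrow> 'a fmat"
  where "flat A = Abs_fmat (\<lambda>i j. ent (ent A (fst (prod_decode i)) (fst (prod_decode j)))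
    (snd (prod_decode i)) (snd (prod_decode j)))"

lemma ex_common_bound: "\<exists>m. \<forall>i<(n::nat). \<forall>j<n. bounded_by m (f i j)"
proof -
  have "\<exists>m. \<forall>(i, j) \<in> {..<n} \<times> {..<n}. bounded_by m (f i j)"
  proof (rule finite_induct [where P = "\<lambda>S. \<exists>m. \<forall>(i, j) \<in> S. bounded_by m (f i j)"])
    fix x S
    assume "\<exists>m. \<forall>(i, j)\<in>S. bounded_by m (f i j)"
    then obtain m where m: "\<forall>(i, j)\<in>S. bounded_by m (f i j)" ..
    obtain n where n: "bounded_by n (f (fst x) (snd x))"
      using bounded_by_ex by blast
    show "\<exists>m. \<forall>(i, j)\<in>insert x S. bounded_by m (f i j)"
      using m n by (intro exI [of _ "max m n"]) (auto intro: bounded_by_max)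
  qed (simp_all add: finite_cartesian_product)
  then show ?thesis by fastforce
qed

lemma ent_flat:
  "ent (flat A) i j = ent (ent A (fst (prod_decode i)) (fst (prod_decode j)))
    (snd (prod_decode i)) (snd (prod_decode j))"
proof -
  obtain n where n: "bounded_by n A"
    using bounded_by_ex by blast
  obtain m where m: "\<forall>k<n. \<forall>l<n. bounded_by m (ent A k l)"
    using ex_common_bound by blast
  \<comment> \<open>\<open>N\<close> exceeds the code of every pair that can index a nonzero entry,
    so the function in \<open>flat\<close> has finite support and \<open>Abs_fmat\<close> can be
    inverted on it.\<close>
  define N where "N = Suc (Max (prod_encode ` ({..<n} \<times> {..<m})))"
  have z: "ent (ent A k l) k' l' = 0" if "n \<le> k \<or> n \<le> l \<or> m \<le> k' \<or> m \<le> l'" for k l k' l'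
    using that n m by (cases "n \<le> k \<or> n \<le> l") (auto simp: ent_zero bounded_byD [of n] bounded_byD [of m] not_le)
  have N: "n \<le> fst (prod_decode i) \<or> m \<le> snd (prod_decode i)" if "N \<le> i" for i
  proof (rule ccontr)
    assume "\<not> ?thesis"
    then have "i \<in> prod_encode ` ({..<n} \<times> {..<m})"
      by (intro image_eqI [of _ _ "prod_decode i"]) (auto simp: mem_Times_iff)
    then have "i < N"
      unfolding N_def by (intro le_imp_less_Suc Max_ge) auto
    then show False using that by simp
  qed
  show ?thesis
    unfolding flat_def
    by (subst Abs_fmat_inverse) (use N z in blast)+
qed

lemma ent_flat_encode: "ent (flat A) (prod_encode (k, i)) (prod_encode (l, j)) = ent (ent A k l) i j"
  by (simp add: ent_flat)

lemma flat_eqI: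
  assumes "\<And>k i l j. ent a (prod_encode (k, i)) (prod_encode (l, j)) = ent b (prod_encode (k, i)) (prod_encode (l, j))"
  shows "a = b"
  by (rule fmat_eqI) (metis assms prod_decode_inverse surj_pair)

lemma flat_add: "flat (A + B) = flat A + flat B"
  by (rule fmat_eqI) (simp add: ent_flat ent_add)

lemma flat_minus: "flat (- A) = - flat A"
  by (rule fmat_eqI) (simp add: ent_flat ent_minus)

lemma flat_zero: "flat 0 = 0"
  by (rule fmat_eqI) (simp add: ent_flat ent_zero)

lemma ent_sum: "ent (\<Sum>x\<in>S. f x) i j = (\<Sum>x\<in>S. ent (f x) i j)"
  by (induction S rule: infinite_finite_induct) (auto simp: ent_simps)

lemma flat_mult: "flat (A * B) = flat A * flat B"
proof (rule flat_eqI)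
  fix k i l j
  obtain n where n: "bounded_by n A" "bounded_by n B"
    using bounded_by_ex2 by blast
  obtain m where m: "\<forall>k<n. \<forall>l<n. bounded_by m (ent A k l)"
    using ex_common_bound by blast
  have m': "bounded_by m (ent A k l)" for k l
    by (cases "k < n \<and> l < n") (use n m in \<open>auto simp: bounded_byD bounded_by_zero not_less\<close>)
  have "ent (flat (A * B)) (prod_encode (k, i)) (prod_encode (l, j))
     = (\<Sum>k'<n. \<Sum>i'<m. ent (ent A k k') i i' * ent (ent B k' l) i' j)"
    using n m' by (simp add: ent_flat_encode ent_mult [of n] ent_sum ent_mult [of m])
  also have "\<dots> = (\<Sum>x\<in>{..<n} \<times> {..<m}. ent (flat A) (prod_encode (k, i)) (prod_encode x)
      * ent (flat B) (prod_encode x) (prod_encode (l, j)))"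
    by (simp add: sum.cartesian_product ent_flat_encode split_def ent_flat)
  also have "\<dots> = (\<Sum>x\<in>prod_encode ` ({..<n} \<times> {..<m}). ent (flat A) (prod_encode (k, i)) x
      * ent (flat B) x (prod_encode (l, j)))"
    by (subst sum.reindex) (auto simp: inj_on_def)
  also have "\<dots> = ent (flat A * flat B) (prod_encode (k, i)) (prod_encode (l, j))"
  proof (rule ent_mult_on [symmetric])
    fix x assume x: "x \<notin> prod_encode ` ({..<n} \<times> {..<m})"
    then have "n \<le> fst (prod_decode x) \<or> m \<le> snd (prod_decode x)"
      by (metis image_eqI lessThan_iff linorder_not_le mem_Times_iff prod_decode_inverse)
    then show "ent (flat A) (prod_encode (k, i)) x = 0 \<or> ent (flat B) x (prod_encode (l, j)) = 0"
      using n m' by (auto simp: ent_flat bounded_byD [of n] bounded_byD [of m] ent_zero)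
  qed simp
  finally show "ent (flat (A * B)) (prod_encode (k, i)) (prod_encode (l, j))
     = ent (flat A * flat B) (prod_encode (k, i)) (prod_encode (l, j))" .
qed

definition blk :: "'a::ring fmat \<Rightarrow> 'a fmat \<Rightarrow> 'a fmat \<Rightarrow> 'a fmat \<Rightarrow> 'a fmat"
  where "blk a b c d = flat (sg 0 0 a + sg 0 1 b + sg 1 0 c + sg 1 1 d)"

lemma blk_add: "blk a b c d + blk a' b' c' d' = blk (a + a') (b + b') (c + c') (d + d')"
  by (simp add: blk_def sg_add flat_add)

lemma blk_minus: "- blk a b c d = blk (- a) (- b) (- c) (- d)"
  by (simp only: blk_def sg_minus flat_add flat_minus minus_add_distrib)

lemma blk_zero: "blk 0 0 0 0 = 0"
  by (simp add: blk_def sg_zero flat_zero)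

lemma blk_mult: "blk a b c d * blk a' b' c' d' =
    blk (a * a' + b * c') (a * b' + b * d') (c * a' + d * c') (c * b' + d * d')"
  unfolding blk_def flat_mult [symmetric]
  by (simp add: distrib_left distrib_right sg_mult_sg sg_add add_ac flip: One_nat_def)

lemma ent_blk: "ent (blk a b c d) (prod_encode (k, i)) (prod_encode (l, j)) =
   (if k = 0 \<and> l = 0 then ent a i j else if k = 0 \<and> l = 1 then ent b i j
    else if k = 1 \<and> l = 0 then ent c i j else if k = 1 \<and> l = 1 then ent d i j else 0)"
  by (auto simp: blk_def ent_flat_encode ent_simps ent_sg)

lemma fmap_blk:
  assumes "h 0 = 0"
  shows "fmap h (blk a b c d) = blk (fmap h a) (fmap h b) (fmap h c) (fmap h d)"
  by (rule flat_eqI) (simp add: ent_fmap ent_blk assms)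

section \<open>Strong shift equivalence and companion matrices\<close>

definition esse :: "'a::times \<Rightarrow> 'a \<Rightarrow> bool"
  where "esse a b \<longleftrightarrow> (\<exists>r s. a = r * s \<and> b = s * r)"

abbreviation sse :: "'a::times \<Rightarrow> 'a \<Rightarrow> bool"
  where "sse \<equiv> esse\<^sup>*\<^sup>*"

lemma sse_sym: "sse a b \<Longrightarrow> sse b a"
proof -
  have "symp (esse :: 'a::times \<Rightarrow> 'a \<Rightarrow> bool)"
    unfolding symp_def esse_def by metis
  then show "sse (a::'a) b \<Longrightarrow> sse b a"
    by (metis sympD symp_rtranclp)
qed

lemma sse_trans: "sse a b \<Longrightarrow> sse b c \<Longrightarrow> sse a c"
  by (rule rtranclp_trans)

lemma sse_eqI: "a = r * s \<Longrightarrow> b = s * r \<Longrightarrow> sse a b"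
  by (rule r_into_rtranclp) (auto simp: esse_def)

lemma sse_flat:
  assumes "sse A B"
  shows "sse (flat A) (flat B)"
  using assms
proof induction
  case (step B C)
  then have "esse (flat B) (flat C)"
    unfolding esse_def by (metis flat_mult)
  with step.IH show ?case by (rule rtranclp.rtrancl_into_rtrancl)
qed simp

section \<open>Reindexing along injections\<close>

definition reidx :: "(nat \<Rightarrow> nat) \<Rightarrow> 'a::zero fmat \<Rightarrow> 'a fmat"
  where "reidx f a =
    Abs_fmat (\<lambda>i j. if i \<in> range f \<and> j \<in> range f then ent a (inv_into UNIV f i) (inv_into UNIV f j) else 0)"

lemma ent_reidx':
  assumes "inj f"
  shows "ent (reidx f a) i j = (if i \<in> range f \<and> j \<in> range f then ent a (inv_into UNIV f i) (inv_into UNIV f j) else 0)"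
proof -
  obtain n where n: "bounded_by n a"
    using bounded_by_ex by blast
  define N where "N = Suc (Max (f ` {..<n}))"
  have N: "n \<le> k" if "N \<le> f k" for k
  proof (rule ccontr)
    assume "\<not> n \<le> k"
    then have "f k < N"
      unfolding N_def by (intro le_imp_less_Suc Max_ge) auto
    then show False using that by simp
  qed
  have "\<exists>n. \<forall>i j. n \<le> i \<or> n \<le> j \<longrightarrow>
      (if i \<in> range f \<and> j \<in> range f then ent a (inv_into UNIV f i) (inv_into UNIV f j) else 0) = 0"
    using n N assms by (intro exI [of _ N]) (auto simp: bounded_byD [OF n])
  then show ?thesis
    unfolding reidx_def by (subst Abs_fmat_inverse) auto
qed

lemma ent_reidx: "inj f \<Longrightarrow> ent (reidx f a) (f i) (f j) = ent a i j"
  by (simp add: ent_reidx')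

lemma ent_reidx_0:
  "inj f \<Longrightarrow> i \<notin> range f \<or> j \<notin> range f \<Longrightarrow> ent (reidx f a) i j = 0"
  by (auto simp: ent_reidx')

lemma reidx_eqI:
  assumes "inj f" "\<And>i j. ent b (f i) (f j) = ent a i j"
    "\<And>i j. i \<notin> range f \<or> j \<notin> range f \<Longrightarrow> ent b i j = 0"
  shows "reidx f a = b"
proof (rule fmat_eqI)
  fix i j
  show "ent (reidx f a) i j = ent b i j"
  proof (cases "i \<in> range f \<and> j \<in> range f")
    case True
    then show ?thesis by (auto simp: assms ent_reidx)
  next
    case False
    then show ?thesis using assms(3) [of i j] by (auto simp: ent_reidx' assms(1))
  qed
qed

lemma inj_prod_encode_pair: "inj (\<lambda>i. prod_encode (k, i))"
  by (auto simp: inj_def)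

lemma flat_sg_diag: "flat (sg k k a) = reidx (\<lambda>i. prod_encode (k, i)) a"
proof (rule reidx_eqI [OF inj_prod_encode_pair, symmetric])
  show "ent (flat (sg k k a)) (prod_encode (k, i)) (prod_encode (k, j)) = ent a i j" for i j
    by (simp add: ent_flat_encode ent_sg)
  fix i j assume *: "i \<notin> range (\<lambda>i. prod_encode (k, i)) \<or> j \<notin> range (\<lambda>i. prod_encode (k, i))"
  then have "fst (prod_decode i) \<noteq> k \<or> fst (prod_decode j) \<noteq> k"
    by (metis prod.collapse prod_decode_inverse rangeI)
  then show "ent (flat (sg k k a)) i j = 0"
    by (auto simp: ent_flat ent_sg ent_zero)
qed

lemma blk_first: "blk a 0 0 0 = reidx (\<lambda>i. prod_encode (0, i)) a"
  by (simp add: blk_def sg_zero flip: flat_sg_diag)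

lemma blk_last: "blk 0 0 0 a = reidx (\<lambda>i. prod_encode (1, i)) a"
  by (simp add: blk_def sg_zero flip: flat_sg_diag)

text \<open>Let \<open>s\<close> be the 0-1 matrix of \<open>f\<close> on the support of
  \<open>a\<close>, and \<open>r\<close> the matrix \<open>a\<close> with only its rows moved by
  \<open>f\<close>. Then \<open>s * r\<close> moves the rows back, while \<open>r * s\<close> moves
  the columns as well.\<close>

lemma sse_reidx:
  fixes a :: "'a::{ring, monoid_mult} fmat"
  assumes f: "inj f"
  shows "sse a (reidx f a)"
proof -
  obtain n0 where n0: "bounded_by n0 a"
    using bounded_by_ex by blast
  obtain n1 where n1: "bounded_by n1 (reidx f a)"
    using bounded_by_ex by blast
  define N where "N = Suc (max (max n0 n1) (Max (f ` {..<n0})))"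
  have N: "f k < N" if "k < n0" for k
    using that unfolding N_def by (intro le_imp_less_Suc max.coboundedI2 Max_ge) auto
  have N': "n0 \<le> N" "n1 \<le> N" by (auto simp: N_def)
  define r where "r = fm N (\<lambda>x j. if x \<in> range f then ent a (inv_into UNIV f x) j else 0)"
  define s :: "'a fmat" where "s = fm N (\<lambda>k x. if k < n0 \<and> x = f k then 1 else 0)"
  have "a = s * r"
  proof (rule fmat_eqI)
    show "ent a i j = ent (s * r) i j" for i j
      using f N N' n0 by (subst ent_mult_on [where K = "{f i}"])
        (auto simp: s_def r_def ent_fm bounded_byD [OF n0] not_less dest: N)
  qed
  moreover have "reidx f a = r * s"
  proof (rule reidx_eqI [OF f])
    fix i j
    show "ent (r * s) (f i) (f j) = ent a i j"
    proof (cases "i < n0 \<and> j < n0")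
      case True
      then show ?thesis
        using f N N' by (subst ent_mult_on [where K = "{j}"])
          (auto simp: s_def r_def ent_fm injD dest: injD intro: less_le_trans)
    next
      case False
      then show ?thesis
        using f N N' n0 by (subst ent_mult_on [where K = "{j}"])
          (auto simp: s_def r_def ent_fm bounded_byD [OF n0] not_less dest: injD)
    qed
  next
    fix i j assume *: "i \<notin> range f \<or> j \<notin> range f"
    then show "ent (r * s) i j = 0"
      by (subst ent_mult_on [where K = "{}"]) (auto simp: s_def r_def ent_fm)
  qed
  ultimately show ?thesis
    by (metis sse_eqI)
qed

text \<open>The coefficient matrix of \<open>x\<^sub>n\<^sub>+\<^sub>1 = M\<^sub>1 x\<^sub>n + \<dots> + M\<^sub>d x\<^sub>n\<^sub>-\<^sub>d\<^sub>+\<^sub>1\<close> as a first-order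
  recursion on \<open>(x\<^sub>n, \<dots>, x\<^sub>n\<^sub>-\<^sub>d\<^sub>+\<^sub>1)\<close>; the element \<open>p\<close> acts as the unit on the coefficients.\<close>

definition companion :: "'a::zero \<Rightarrow> (nat \<Rightarrow> 'a) \<Rightarrow> nat \<Rightarrow> 'a fmat"
  where "companion p M d = fm d (\<lambda>i j. if i = 0 then M (Suc j) else if i = Suc j then p else 0)"

lemma sum_if_eq:
  fixes g :: "nat \<Rightarrow> 'a::ring"
  shows "(\<Sum>k<n. (if k = i then x else 0) * g k) = (if i < n then x * g i else 0)"
    "(\<Sum>k<n. (if i = k then x else 0) * g k) = (if i < n then x * g i else 0)"
    "(\<Sum>k<n. g k * (if k = i then x else 0)) = (if i < n then g i * x else 0)"
    "(\<Sum>k<n. g k * (if i = k then x else 0)) = (if i < n then g i * x else 0)"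
  by (simp_all add: if_distrib [of "\<lambda>x. x * _"] if_distrib [of "\<lambda>x. _ * x"] cong: if_cong)

lemma companion_1: "companion p M 1 = sg 0 0 (M 1)"
  by (rule fmat_eqI) (auto simp: companion_def ent_fm ent_sg)

text \<open>A vanishing top coefficient makes the last column of the larger companion matrix zero.
  Multiplying by \<open>q\<close> on the right therefore changes nothing, while on the left it
  deletes the last row.\<close>

lemma companion_extend:
  fixes p :: "'a::ring"
  assumes "p * p = p" "\<And>k. p * M k = M k" "\<And>k. M k * p = M k" "M (Suc d) = 0"
  shows "sse (companion p M (Suc d)) (companion p M d)"
proof (rule sse_eqI)
  define q where "q = fm d (\<lambda>i j. if i = j then p else 0)"
  show "companion p M (Suc d) = companion p M (Suc d) * q"
  proof (rule fmat_eqI)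
    show "ent (companion p M (Suc d)) i j = ent (companion p M (Suc d) * q) i j" for i j
      using assms by (subst ent_mult_on [where K = "{j}"])
        (auto simp: companion_def q_def ent_fm less_Suc_eq)
  qed
  show "companion p M d = q * companion p M (Suc d)"
  proof (rule fmat_eqI)
    show "ent (companion p M d) i j = ent (q * companion p M (Suc d)) i j" for i j
      using assms by (subst ent_mult_on [where K = "{i}"])
        (auto simp: companion_def q_def ent_fm less_Suc_eq)
  qed
qed

lemma companion_extend_many:
  fixes p :: "'a::ring"
  assumes "p * p = p" "\<And>k. p * M k = M k" "\<And>k. M k * p = M k" "\<And>k. d < k \<Longrightarrow> M k = 0" "d \<le> e"
  shows "sse (companion p M e) (companion p M d)"
  using \<open>d \<le> e\<close>
proof (induction rule: dec_induct)
  case (step n)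
  have "sse (companion p M (Suc n)) (companion p M n)"
    using assms step by (intro companion_extend) auto
  with step.IH show ?case by simp
qed simp

text \<open>Conjugation by the diagonal matrix with \<open>h\<close> in all \<open>d\<close> places,
  where \<open>g\<close> is the inverse of \<open>h\<close> relative to the unit \<open>p\<close>.
  The lower entries survive because \<open>h * p * g = p\<close>.\<close>

lemma companion_conj:
  fixes p :: "'a::ring"
  assumes "p * p = p" "\<And>k. p * M k = M k" "\<And>k. M k * p = M k"
    and "h * g = p" "g * h = p" "h * p = h" "p * g = g"
  shows "sse (companion p (\<lambda>k. h * M k * g) d) (companion p M d)"
proof (rule sse_eqI)
  define D where "D x = fm d (\<lambda>i j. if i = j then x else 0)" for x :: 'a
  have l: "ent (D x * a) i j = (if i < d then x * ent a i j else 0)" for x a i j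
    by (subst ent_mult_on [where K = "{i}"]) (auto simp: D_def ent_fm)
  have r: "ent (a * D x) i j = (if j < d then ent a i j * x else 0)" for x a i j
    by (subst ent_mult_on [where K = "{j}"]) (auto simp: D_def ent_fm)
  show "companion p (\<lambda>k. h * M k * g) d = D h * (companion p M d * D g)"
    by (rule fmat_eqI) (use assms in \<open>auto simp: l r companion_def ent_fm mult.assoc\<close>)
  have *: "M k * g * h = M k" for k
    using assms by (simp add: mult.assoc)
  show "companion p M d = companion p M d * D g * D h"
    by (rule fmat_eqI) (use assms * in \<open>auto simp: l r companion_def ent_fm\<close>)
qed

text \<open>If \<open>x\<close> solves the recursion of \<open>1 - M\<close> up to the error \<open>\<rho>\<^sub>n = x\<^sub>n - M\<^sub>1 x\<^sub>n\<^sub>-\<^sub>1 - \<dots>\<close>, then the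
  one of \<open>(1 + tX)(1 - M)\<close> says \<open>\<rho>\<^sub>n\<^sub>+\<^sub>1 = - X \<rho>\<^sub>n\<close>. As \<open>X = u w\<close> with \<open>w u = 0\<close>, the states
  \<open>(w \<rho>\<^sub>n, x\<^sub>n, \<dots>, x\<^sub>n\<^sub>-\<^sub>d\<^sub>+\<^sub>1)\<close> suffice, and the first one vanishes after one step.\<close>

lemma companion_left:
  fixes p :: "'a::ring"
  assumes p: "p * p = p" "\<And>k. p * M k = M k" "\<And>k. M k * p = M k"
    and u: "p * u = u" "u * p = u" "w * p = w" "w * u = 0"
    and M: "\<And>k. d < k \<Longrightarrow> M k = 0"
    and M': "M' 1 = M 1 - u * w" "\<And>k. M' (Suc (Suc k)) = M (Suc (Suc k)) + u * w * M (Suc k)"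
  shows "sse (companion p M' (Suc d)) (companion p M d)"
proof -
  \<comment> \<open>\<open>S\<close> sends \<open>(x_n, ..., x_(n-d))\<close> to the states
    \<open>(w \<rho>_n, x_n, ..., x_(n-d+1))\<close>, and \<open>R\<close> computes
    \<open>(x_(n+1), ..., x_(n-d+1))\<close> from these.\<close>
  define R where "R = fm (Suc d) (\<lambda>i j. if i = 0 then if j = 0 then - u else M j
    else if i = j then p else 0)"
  define S where "S = fm (Suc d) (\<lambda>i j. if i = 0 then if j = 0 then w else - (w * M j)
    else if i = Suc j then p else 0)"
  \<comment> \<open>Row 0 of \<open>S * R\<close> is zero because \<open>w * u = 0\<close>.
    \<open>S'\<close> puts a zero in place of the first state and \<open>R'\<close> drops the last
    output, so \<open>S' * R'\<close> is \<open>S * R\<close> again and \<open>R' * S'\<close> has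
    lost the extra state.\<close>
  define S' where "S' = fm (Suc d) (\<lambda>i j. if i = Suc j then p else 0)"
  define R' where "R' = fm (Suc d) (\<lambda>i j. if i < d then ent R i j else 0)"
  have b: "bounded_by (Suc d) R"
    by (simp add: R_def bounded_by_fm)
  have sum0: "(\<Sum>k<Suc d. f k) = f 0 + (\<Sum>k<d. f (Suc k))" for f :: "nat \<Rightarrow> 'a"
    by (rule sum.lessThan_Suc_shift)
  have M0: "M (Suc (Suc k)) = 0" if "\<not> Suc k < d" for k
    using that by (intro M) simp
  have 1: "companion p M' (Suc d) = R * S"
  proof (rule fmat_eqI)
    fix i j
    show "ent (companion p M' (Suc d)) i j = ent (R * S) i j"
      unfolding ent_mult [OF disjI1 [OF b]] sum0
      by (cases i; cases j)
        (use p u M M0 M' in \<open>auto simp: R_def S_def companion_def ent_fm sum_if_eq mult.assoc less_Suc_eq_0_disj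
          cong: if_cong\<close>)
  qed
  have 2: "S * R = S' * R'"
  proof (rule fmat_eqI)
    fix i j
    show "ent (S * R) i j = ent (S' * R') i j"
    proof (cases i)
      case 0
      have "ent (S * R) i j = 0"
        unfolding 0 by (subst ent_mult_on [where K = "{0, j}"])
          (use p u in \<open>auto simp: R_def S_def ent_fm mult.assoc\<close>)
      moreover have "ent (S' * R') i j = 0"
        unfolding 0 by (subst ent_mult_on [where K = "{}"]) (auto simp: S'_def ent_fm)
      ultimately show ?thesis by simp
    next
      case (Suc k)
      have "ent (S * R) i j = ent S i k * ent R k j"
        unfolding Suc by (subst ent_mult_on [where K = "{k}"]) (auto simp: S_def ent_fm)
      moreover have "ent (S' * R') i j = ent S' i k * ent R' k j"
        unfolding Suc by (subst ent_mult_on [where K = "{k}"]) (auto simp: S'_def ent_fm)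
      ultimately show ?thesis
        unfolding Suc by (auto simp: S_def S'_def R'_def ent_fm bounded_byD [OF b])
    qed
  qed
  have 3: "R' * S' = companion p M d"
  proof (rule fmat_eqI)
    fix i j
    show "ent (R' * S') i j = ent (companion p M d) i j"
      by (subst ent_mult_on [where K = "{Suc j}"])
        (use p u in \<open>auto simp: R_def R'_def S'_def companion_def ent_fm\<close>)
  qed
  show ?thesis
    using sse_trans [OF sse_eqI [OF 1 2 [symmetric]] sse_eqI [OF refl 3 [symmetric]]] .
qed

text \<open>If \<open>x'\<close> solves the recursion of \<open>(1 - M)(1 + tX)\<close>, then \<open>x\<^sub>n = x'\<^sub>n + X x'\<^sub>n\<^sub>-\<^sub>1\<close> solves the one
  of \<open>1 - M\<close>. Now the states \<open>(x\<^sub>n, \<dots>, x\<^sub>n\<^sub>-\<^sub>d\<^sub>+\<^sub>1, w x'\<^sub>n\<^sub>-\<^sub>d)\<close> suffice.\<close>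

lemma companion_right:
  fixes p :: "'a::ring"
  assumes p: "p * p = p" "\<And>k. p * M k = M k" "\<And>k. M k * p = M k"
    and u: "p * u = u" "w * p = w" "w * u = 0"
    and "0 < d" and M: "\<And>k. d < k \<Longrightarrow> M k = 0"
    and M': "M' 1 = M 1 - u * w" "\<And>k. M' (Suc (Suc k)) = M (Suc (Suc k)) + M (Suc k) * u * w"
  shows "sse (companion p M' (Suc d)) (companion p M d)"
proof -
  obtain e where d: "d = Suc e"
    using \<open>0 < d\<close> by (cases d) auto
  \<comment> \<open>\<open>S\<close> computes the states from the \<open>x'\<close>, and
    \<open>R\<close> advances by one step and returns to the \<open>x'\<close>. As
    \<open>w * u = 0\<close>, \<open>w x'_k = w x_k\<close>, so
    \<open>x'_k = x_k - u w x_(k-1)\<close>; only the oldest one has to use the extra state.\<close>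
  define R where "R = fm (Suc d) (\<lambda>i j. if i = 0 then
      (if j < d then M (Suc j) - (if j = 0 then u * w else 0) else 0)
    else if i = Suc j then p else if i = j then (if i < d then - (u * w) else - u) else 0)"
  define S where "S = fm (Suc d) (\<lambda>i j. if i = d then if j = d then w else 0
    else if i = j then p else if j = Suc i then u * w else 0)"
  define Q where "Q = fm d (\<lambda>i j. if i = j then p else 0)"
  have ent_R: "ent R i j = (if i \<le> d \<and> j \<le> d then
      if i = 0 then if j < d then M (Suc j) - (if j = 0 then u * w else 0) else 0
      else if i = Suc j then p else if i = j then if i < d then - (u * w) else - u else 0
    else 0)" for i j
    by (simp add: R_def ent_fm less_Suc_eq_le)
  have w': "w * (u * x) = 0" for x
    using u(3) by (metis mult.assoc mult_zero_left)
  have pu: "p * (u * x) = u * x" for x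
    using u(1) by (metis mult.assoc)
  have wp: "w * (p * x) = w * x" for x
    using u(2) by (metis mult.assoc)
  have S_R: "ent (S * R) i j = (if i < d then p * ent R i j + u * w * ent R (Suc i) j
      else if i = d then w * ent R d j else 0)" for i j
    by (subst ent_mult_on [where K = "{i, Suc i}"]) (auto simp: S_def ent_fm)
  have R_S: "ent (R * S) i j = (if j = 0 then ent R i 0 * p
      else if j < d then ent R i j * p + ent R i (j - 1) * (u * w)
      else if j = d then ent R i (d - 1) * (u * w) + ent R i d * w else 0)" for i j
    by (subst ent_mult_on [where K = "{j - 1, j}"])
      (use d in \<open>auto simp: S_def ent_fm\<close>)
  have 1: "companion p M' (Suc d) = R * S"
  proof (rule fmat_eqI)
    fix i j
    have "j = 0 \<or> j = 1 \<or> (\<exists>k. j = Suc (Suc k))"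
      by (cases j; cases "j - 1") auto
    moreover have "j = d \<Longrightarrow> M (Suc j) = 0"
      using M by simp
    ultimately show "ent (companion p M' (Suc d)) i j = ent (R * S) i j"
      unfolding R_S
      by (elim disjE exE)
        (use p u d M M' in \<open>auto simp: ent_R companion_def ent_fm mult.assoc algebra_simps w' pu wp\<close>)
  qed
  \<comment> \<open>After one step the extra state is a function of the \<open>x_k\<close>: the last
    column of \<open>S * R\<close> is zero by \<open>w * u = 0\<close>, so \<open>Q\<close> can cut
    it off.\<close>
  have 2: "S * R = (S * R) * Q"
  proof (rule fmat_eqI)
    fix i j
    show "ent (S * R) i j = ent ((S * R) * Q) i j"
      by (subst ent_mult_on [where K = "{j}" and b = Q])
        (use p u d in \<open>auto simp: Q_def ent_R S_R ent_fm mult.assoc algebra_simps w' pu wp\<close>)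
  qed
  have 3: "companion p M d = Q * (S * R)"
  proof (rule fmat_eqI)
    fix i j
    show "ent (companion p M d) i j = ent (Q * (S * R)) i j"
      by (subst ent_mult_on [where K = "{i}" and a = Q])
        (use p u d in \<open>auto simp: Q_def ent_R S_R companion_def ent_fm mult.assoc algebra_simps w' pu wp\<close>)
  qed
  show ?thesis
    using sse_trans [OF sse_eqI [OF 1 refl] sse_eqI [OF 2 3]] .
qed

section \<open>Matrices of polynomials and elementary matrices\<close>

lift_definition nmonom :: "nat \<Rightarrow> 'a::zero \<Rightarrow> 'a npoly" is Poly_Mapping.single .

lemma npoly_coeff_nmonom: "npoly_coeff (nmonom k r) i = (if i = k then r else 0)"
  by transfer (simp add: lookup_single when_def)

lemma npoly_coeff_zero: "npoly_coeff (0 :: 'a::ring npoly) k = 0"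
  by transfer simp

lemma npoly_coeff_minus: "npoly_coeff (- (p :: 'a::ring npoly)) k = - npoly_coeff p k"
  by transfer simp

lemmas npoly_coeff_simps = npoly_coeff_nmonom npoly_coeff_zero npoly_coeff_minus npoly_coeff_add

lemma nmonom_zero: "nmonom k (0::'a::ring) = 0"
  by (rule npoly_eqI) (simp add: npoly_coeff_simps)

lemma nmonom_minus: "nmonom k (- (r::'a::ring)) = - nmonom k r"
  by (rule npoly_eqI) (simp add: npoly_coeff_simps)

lemma nmonom_0_1: "nmonom 0 (1::'a::{ring, monoid_mult}) = 1"
  by (rule npoly_eqI) (simp add: npoly_coeff_simps npoly_coeff_one)

lemma npoly_coeff_nmonom_mult:
  fixes f :: "'a::ring npoly"
  shows "npoly_coeff (nmonom j r * f) k = (if j \<le> k then r * npoly_coeff f (k - j) else 0)"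
  by (simp add: npoly_coeff_mult npoly_coeff_nmonom if_distrib [of "\<lambda>x. x * _"] cong: if_cong)

lemma npoly_coeff_bound: "\<exists>d. \<forall>k\<ge>d. npoly_coeff f k = 0"
proof transfer
  fix f :: "nat \<Rightarrow>\<^sub>0 'a"
  have "finite {k. Poly_Mapping.lookup f k \<noteq> 0}"
    by (rule finite_lookup)
  then obtain d where "\<forall>k\<in>{k. Poly_Mapping.lookup f k \<noteq> 0}. k < d"
    unfolding finite_nat_set_iff_bounded by blast
  then show "\<exists>d. \<forall>k\<ge>d. Poly_Mapping.lookup f k = 0"
    by (meson mem_Collect_eq not_le)
qed

lemma ex_npoly_shift: "\<exists>g. \<forall>k. npoly_coeff g k = npoly_coeff f (Suc k)"
proof transfer
  fix f :: "nat \<Rightarrow>\<^sub>0 'a"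
  have "Poly_Mapping.lookup (Poly_Mapping.map_key Suc f) k = Poly_Mapping.lookup f (Suc k)" for k
    by (simp add: map_key.rep_eq)
  then show "\<exists>g. \<forall>k. Poly_Mapping.lookup g k = Poly_Mapping.lookup f (Suc k)"
    by blast
qed

text \<open>Horner form: \<open>f\<close> is its constant coefficient plus \<open>t\<close> times a
  polynomial of smaller degree. Multiplication by \<open>t\<close> alone is the step that the
  commutator formula for transvections can provide.\<close>

lemma npoly_induct:
  fixes f :: "'a::{ring, monoid_mult} npoly"
  assumes const: "\<And>r. P (nmonom 0 r)"
    and add: "\<And>f g. P f \<Longrightarrow> P g \<Longrightarrow> P (f + g)"
    and shift: "\<And>f. P f \<Longrightarrow> P (nmonom 1 1 * f)"
  shows "P f"
proof -
  obtain d where "\<forall>k\<ge>d. npoly_coeff f k = 0"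
    using npoly_coeff_bound by blast
  then show ?thesis
  proof (induction d arbitrary: f)
    case 0
    then have "f = nmonom 0 0"
      by (intro npoly_eqI) (simp add: npoly_coeff_simps)
    then show ?case using const by simp
  next
    case (Suc d)
    obtain g where g: "\<And>k. npoly_coeff g k = npoly_coeff f (Suc k)"
      using ex_npoly_shift by blast
    have "f = nmonom 0 (npoly_coeff f 0) + nmonom 1 1 * g"
    proof (rule npoly_eqI)
      show "npoly_coeff f k = npoly_coeff (nmonom 0 (npoly_coeff f 0) + nmonom 1 1 * g) k" for k
        by (cases k) (auto simp: npoly_coeff_simps npoly_coeff_nmonom_mult g)
    qed
    moreover have "P g"
      using Suc by (simp add: g)
    ultimately show ?case
      using const add shift by metis
  qed
qed

section \<open>Coefficient matrices of polynomial matrices\<close>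

definition cf :: "nat \<Rightarrow> 'a::ring npoly fmat \<Rightarrow> 'a fmat"
  where "cf k = fmap (\<lambda>f. npoly_coeff f k)"

text \<open>The matrix \<open>t ^ k a\<close>.\<close>

definition tau :: "nat \<Rightarrow> 'a::ring fmat \<Rightarrow> 'a npoly fmat"
  where "tau k = fmap (nmonom k)"

lemma ent_cf: "ent (cf k a) i j = npoly_coeff (ent a i j) k"
  by (simp add: cf_def ent_fmap npoly_coeff_zero)

lemma ent_tau: "ent (tau k a) i j = nmonom k (ent a i j)"
  by (simp add: tau_def ent_fmap nmonom_zero)

lemma cf_eqI: "(\<And>k. cf k a = cf k b) \<Longrightarrow> a = b"
  by (intro fmat_eqI npoly_eqI) (metis ent_cf)

lemma cf_zero: "cf k 0 = 0"
  and cf_add: "cf k (a + b) = cf k a + cf k b"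
  and cf_minus: "cf k (- a) = - cf k a"
  by (rule fmat_eqI, simp add: ent_cf ent_simps npoly_coeff_simps)+

lemma cf_diff: "cf k (a - b) = cf k a - cf k b"
  by (metis cf_add cf_minus diff_conv_add_uminus)

lemma cf_tau: "cf k (tau j a) = (if k = j then a else 0)"
  by (rule fmat_eqI) (simp add: ent_cf ent_tau ent_simps npoly_coeff_simps)

lemma cf_mult: "cf k (a * b) = (\<Sum>i\<le>k. cf i a * cf (k - i) b)"
proof (rule fmat_eqI)
  fix i j
  obtain n where n: "bounded_by n a"
    using bounded_by_ex by blast
  have n': "bounded_by n (cf k a)" for k
    unfolding cf_def using n by (simp add: bounded_by_fmap npoly_coeff_zero)
  have s: "npoly_coeff (\<Sum>x\<in>S. f x) k = (\<Sum>x\<in>S. npoly_coeff (f x) k)"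
    for S :: "nat set" and f :: "nat \<Rightarrow> 'a npoly"
    by (induction S rule: infinite_finite_induct) (auto simp: npoly_coeff_simps)
  have "ent (cf k (a * b)) i j
      = (\<Sum>l<n. \<Sum>m\<le>k. npoly_coeff (ent a i l) m * npoly_coeff (ent b l j) (k - m))"
    using n by (simp add: ent_cf ent_mult [of n] s npoly_coeff_mult)
  also have "\<dots> = (\<Sum>m\<le>k. \<Sum>l<n. npoly_coeff (ent a i l) m * npoly_coeff (ent b l j) (k - m))"
    by (rule sum.swap)
  also have "\<dots> = ent (\<Sum>i\<le>k. cf i a * cf (k - i) b) i j"
    using n' by (simp add: ent_sum ent_mult [of n] ent_cf)
  finally show "ent (cf k (a * b)) i j = ent (\<Sum>i\<le>k. cf i a * cf (k - i) b) i j" .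
qed

lemma cf_0_mult: "cf 0 (a * b) = cf 0 a * cf 0 b"
  by (simp add: cf_mult)

lemma cf_tau_mult: "cf k (tau j a * b) = (if j \<le> k then a * cf (k - j) b else 0)"
  by (simp add: cf_mult cf_tau if_distrib [of "\<lambda>x. x * _"] cong: if_cong)

lemma cf_mult_tau: "cf k (b * tau j a) = (if j \<le> k then cf (k - j) b * a else 0)"
proof -
  have "cf k (b * tau j a) = (\<Sum>i\<le>k. cf (k - i) b * (if i = j then a else 0))"
    unfolding cf_mult cf_tau by (rule sum.reindex_bij_witness [of _ "\<lambda>i. k - i" "\<lambda>i. k - i"]) auto
  then show ?thesis
    by (simp add: if_distrib [of "\<lambda>x. _ * x"] cong: if_cong)
qed

lemma tau_mult: "tau j a * tau k b = tau (j + k) (a * b)"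
  by (rule cf_eqI) (auto simp: cf_tau_mult cf_tau)

lemma tau_zero: "tau k 0 = 0"
  and tau_add: "tau k (a + b) = tau k a + tau k b"
  by (rule cf_eqI, simp add: cf_tau cf_add cf_minus cf_zero)+

lemma tau_sg: "tau k (sg i j r) = sg i j (nmonom k r)"
  by (simp add: tau_def fmap_sg nmonom_zero)

lemma tau_idm: "tau 0 (idm n) = idm n"
  by (rule fmat_eqI) (simp add: ent_tau ent_idm nmonom_0_1 nmonom_zero)

lemma cf_idm: "cf k (idm n) = (if k = 0 then idm n else 0)"
  by (simp add: cf_tau flip: tau_idm)

lemma tau_blk: "tau k (blk a b c d) = blk (tau k a) (tau k b) (tau k c) (tau k d)"
  by (simp add: tau_def fmap_blk nmonom_zero)

lemma cf_blk: "cf k (blk a b c d) = blk (cf k a) (cf k b) (cf k c) (cf k d)"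
  by (simp add: cf_def fmap_blk npoly_coeff_zero)

lemma bounded_by_tau: "bounded_by n a \<Longrightarrow> bounded_by n (tau k a)"
  by (simp add: tau_def bounded_by_fmap nmonom_zero)

lemma bounded_by_cf: "bounded_by n a \<Longrightarrow> bounded_by n (cf k a)"
  by (simp add: cf_def bounded_by_fmap npoly_coeff_zero)

lemma cf_bound: "\<exists>d. \<forall>k\<ge>d. cf k a = 0"
proof -
  obtain n where n: "bounded_by n a"
    using bounded_by_ex by blast
  define D where "D i j = (SOME d. \<forall>k\<ge>d. npoly_coeff (ent a i j) k = 0)" for i j
  have D: "npoly_coeff (ent a i j) k = 0" if "D i j \<le> k" for i j k
    using someI_ex [OF npoly_coeff_bound [of "ent a i j"]] that by (simp add: D_def)
  define d where "d = Max ((\<lambda>(i, j). D i j) ` ({..n} \<times> {..n}))"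
  have d: "D i j \<le> d" if "i < n" "j < n" for i j
    unfolding d_def using that by (intro Max_ge) (auto intro!: rev_image_eqI [of "(i, j)"])
  have "cf k a = 0" if "d \<le> k" for k
  proof (rule fmat_eqI)
    show "ent (cf k a) i j = ent 0 i j" for i j
    proof (cases "i < n \<and> j < n")
      case True
      then have "D i j \<le> k"
        using that d order.trans by blast
      then show ?thesis
        by (simp add: ent_cf ent_zero D)
    next
      case False
      then have "ent a i j = 0"
        using bounded_byD [OF n, of i j] by auto
      then show ?thesis
        by (simp add: ent_cf ent_zero npoly_coeff_zero)
    qed
  qed
  then show ?thesis by blast
qed

text \<open>An element \<open>u\<close> stands for the matrix \<open>1 + u\<close> of infinite size, so that \<open>circ\<close> is the product
  of the stable general linear group and \<open>elc\<close> is its elementary subgroup.\<close>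

definition circ :: "'a::ring \<Rightarrow> 'a \<Rightarrow> 'a"
  where "circ a b = a + b + a * b"

lemma circ_assoc: "circ (circ a b) c = circ a (circ b c)"
  by (simp add: circ_def algebra_simps)

lemma circ_zero: "circ a 0 = a" "circ 0 a = a"
  by (simp_all add: circ_def)

inductive_set elc :: "'a::ring fmat set" where
  zero: "0 \<in> elc"
| step: "u \<in> elc \<Longrightarrow> i \<noteq> j \<Longrightarrow> circ u (sg i j x) \<in> elc"

lemma sg_elc: "i \<noteq> j \<Longrightarrow> sg i j x \<in> elc"
  using elc.step [OF elc.zero] by (simp add: circ_zero)

lemma elc_circ: "v \<in> elc \<Longrightarrow> u \<in> elc \<Longrightarrow> circ u v \<in> elc"
  by (induction v rule: elc.induct) (auto simp: circ_zero elc.step simp flip: circ_assoc)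

lemma elc_inverse: "u \<in> elc \<Longrightarrow> \<exists>v\<in>elc. circ u v = 0 \<and> circ v u = 0"
proof (induction u rule: elc.induct)
  case zero
  then show ?case using elc.zero by (auto simp: circ_zero)
next
  case (step u i j x)
  then obtain v where v: "v \<in> elc" "circ u v = 0" "circ v u = 0" by blast
  have s: "circ (sg i j x) (sg i j (- x)) = 0" "circ (sg i j (- x)) (sg i j x) = 0"
    using \<open>i \<noteq> j\<close> by (auto simp: circ_def sg_minus sg_mult_sg)
  have 1: "circ (circ u (sg i j x)) (circ (sg i j (- x)) v) = 0"
    by (metis s v circ_assoc circ_zero)
  have 2: "circ (circ (sg i j (- x)) v) (circ u (sg i j x)) = 0"
    by (metis s v circ_assoc circ_zero)
  have "circ (sg i j (- x)) v \<in> elc"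
    using v \<open>i \<noteq> j\<close> by (intro elc_circ sg_elc)
  with 1 2 show ?case by blast
qed

section \<open>Elementary equivalence of pencils implies strong shift equivalence\<close>

text \<open>The companion matrix of \<open>M\<close>, where \<open>1 - M = h y\<close> and \<open>h\<close> is the inverse of the constant
  coefficient of \<open>y\<close>, is strong shift equivalent to \<open>c\<close>. Units are relative to size \<open>n\<close>.\<close>

definition Phi :: "nat \<Rightarrow> 'r::{ring, monoid_mult} npoly fmat \<Rightarrow> 'r fmat \<Rightarrow> bool"
  where "Phi n y c \<longleftrightarrow> bounded_by n y \<and>
    (\<exists>h d. bounded_by n h \<and> h * cf 0 y = idm n \<and> cf 0 y * h = idm n \<and> 0 < d \<and>
      (\<forall>k>d. cf k y = 0) \<and> sse c (flat (companion (idm n) (\<lambda>k. - (h * cf k y)) d)))"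

lemma sse_flat_back: "sse c (flat A) \<Longrightarrow> sse B A \<Longrightarrow> sse c (flat B)"
  using sse_flat sse_sym sse_trans by blast

lemma PhiI:
  assumes "bounded_by n y" "bounded_by n h" "h * cf 0 y = idm n" "cf 0 y * h = idm n" "0 < d"
    "\<And>k. d < k \<Longrightarrow> cf k y = 0" "sse c (flat (companion (idm n) (\<lambda>k. - (h * cf k y)) d))"
  shows "Phi n y c"
  using assms unfolding Phi_def by blast

lemma PhiE:
  assumes "Phi n y c"
  obtains h d where "bounded_by n h" "h * cf 0 y = idm n" "cf 0 y * h = idm n" "0 < d"
    "\<And>k. d < k \<Longrightarrow> cf k y = 0" "bounded_by n y"
    "sse c (flat (companion (idm n) (\<lambda>k. - (h * cf k y)) d))"
proof -
  show thesis
    using assms unfolding Phi_def by (elim conjE exE) (rule that; simp)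
qed

text \<open>The new inverse \<open>h * g'\<close> of the constant coefficient cancels
  \<open>g\<close>, so the companion matrix does not change at all.\<close>

lemma Phi_const_left:
  assumes y: "Phi n y c" and g: "bounded_by n g" "bounded_by n g'" "g * g' = idm n" "g' * g = idm n"
  shows "Phi n (tau 0 g * y) c"
proof -
  obtain h d where h: "bounded_by n h" "h * cf 0 y = idm n" "cf 0 y * h = idm n"
    and d: "0 < d" "\<And>k. d < k \<Longrightarrow> cf k y = 0"
    and b: "bounded_by n y" and c: "sse c (flat (companion (idm n) (\<lambda>k. - (h * cf k y)) d))"
    using y by (rule PhiE) blast
  have e: "h * g' * (g * x) = h * x" for x
  proof -
    have "h * g' * (g * x) = h * (g' * g) * x" by (simp add: mult.assoc)
    then show ?thesis by (simp add: g idm_units h)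
  qed
  have f: "g * cf 0 y * (h * g') = idm n"
  proof -
    have "g * cf 0 y * (h * g') = g * (cf 0 y * h) * g'" by (simp add: mult.assoc)
    then show ?thesis by (simp add: g idm_units h)
  qed
  have cfk: "cf k (tau 0 g * y) = g * cf k y" for k
    by (simp add: cf_tau_mult)
  show ?thesis
  proof (rule PhiI [where h = "h * g'" and d = d])
    show "sse c (flat (companion (idm n) (\<lambda>k. - (h * g' * cf k (tau 0 g * y))) d))"
      unfolding cfk e by (rule c)
  qed (simp_all only: cfk e f h d b g bounded_by_tau bounded_by_mult mult_zero_right)
qed

text \<open>Here the factor does not cancel: dividing by the new constant coefficient conjugates
  every coefficient by \<open>g\<close>.\<close>

lemma Phi_const_right:
  assumes y: "Phi n y c" and g: "bounded_by n g" "bounded_by n g'" "g * g' = idm n" "g' * g = idm n"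
  shows "Phi n (y * tau 0 g) c"
proof -
  obtain h d where h: "bounded_by n h" "h * cf 0 y = idm n" "cf 0 y * h = idm n"
    and d: "0 < d" "\<And>k. d < k \<Longrightarrow> cf k y = 0"
    and b: "bounded_by n y" and c: "sse c (flat (companion (idm n) (\<lambda>k. - (h * cf k y)) d))"
    using y by (rule PhiE) blast
  have bk: "bounded_by n (cf k y)" for k
    using b by (rule bounded_by_cf)
  have e: "g' * h * (cf 0 y * g) = idm n"
  proof -
    have "g' * h * (cf 0 y * g) = g' * (h * cf 0 y) * g" by (simp add: mult.assoc)
    then show ?thesis by (simp add: g idm_units h)
  qed
  have f: "cf 0 y * g * (g' * h) = idm n"
  proof -
    have "cf 0 y * g * (g' * h) = cf 0 y * (g * g') * h" by (simp add: mult.assoc)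
    then show ?thesis by (simp add: g idm_units h bk)
  qed
  have "sse (companion (idm n) (\<lambda>k. g' * - (h * cf k y) * g) d) (companion (idm n) (\<lambda>k. - (h * cf k y)) d)"
    using g h bk by (intro companion_conj) (simp_all add: idm_units bounded_by_intros bounded_by_idm)
  then have "sse c (flat (companion (idm n) (\<lambda>k. g' * - (h * cf k y) * g) d))"
    by (rule sse_flat_back [OF c])
  then have *: "sse c (flat (companion (idm n) (\<lambda>k. - (g' * h * (cf k y * g))) d))"
    by (simp add: mult.assoc)
  have cfk: "cf k (y * tau 0 g) = cf k y * g" for k
    by (simp add: cf_mult_tau)
  show ?thesis
  proof (rule PhiI [where h = "g' * h" and d = d])
    show "sse c (flat (companion (idm n) (\<lambda>k. - (g' * h * cf k (y * tau 0 g))) d))"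
      unfolding cfk by (rule *)
  qed (simp_all only: cfk e f h d b g bounded_by_tau bounded_by_mult mult_zero_left)
qed

lemma Phi_left:
  assumes y: "Phi n y c" and u: "bounded_by n u" "bounded_by n w" "w * u = 0"
  shows "Phi n ((idm n + tau 1 (u * w)) * y) c"
proof -
  obtain h d where h: "bounded_by n h" "h * cf 0 y = idm n" "cf 0 y * h = idm n"
    and d: "0 < d" "\<And>k. d < k \<Longrightarrow> cf k y = 0"
    and b: "bounded_by n y" and c: "sse c (flat (companion (idm n) (\<lambda>k. - (h * cf k y)) d))"
    using y by (rule PhiE) blast
  have bk: "bounded_by n (cf k y)" for k
    using b by (rule bounded_by_cf)
  note bs = bounded_by_intros bounded_by_idm bounded_by_tau h(1) u(1,2) bk b
  define y' where "y' = (idm n + tau 1 (u * w)) * y"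
  have b': "bounded_by n y'" unfolding y'_def by (simp add: bs)
  have cf0: "cf 0 y' = cf 0 y"
    by (simp add: y'_def cf_tau_mult distrib_right cf_add idm_units bs)
  have cfS: "cf (Suc k) y' = cf (Suc k) y + u * w * cf k y" for k
    by (simp add: y'_def cf_tau_mult distrib_right cf_add idm_units bs)
  have hh': "cf 0 y * (h * x) = x" if "bounded_by n x" for x
    using that h by (metis idm_units(1) mult.assoc)
  \<comment> \<open>Moving the normalizing factor \<open>h\<close> past the transvection gives
    \<open>h (1 + t u w) = (1 + t (h u) (w y_0)) h\<close> with \<open>y_0 = cf 0 y\<close>; the new
    pair still satisfies \<open>(w y_0) (h u) = w u = 0\<close>.\<close>
  have "sse (companion (idm n) (\<lambda>k. - (h * cf k y')) (Suc d)) (companion (idm n) (\<lambda>k. - (h * cf k y)) d)"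
  proof (rule companion_left [where u = "h * u" and w = "w * cf 0 y"])
    show "w * cf 0 y * (h * u) = 0"
      using u by (simp add: mult.assoc hh')
    show "- (h * cf 1 y') = - (h * cf 1 y) - h * u * (w * cf 0 y)"
      by (simp add: cfS algebra_simps)
    show "- (h * cf (Suc (Suc k)) y') =
      - (h * cf (Suc (Suc k)) y) + h * u * (w * cf 0 y) * - (h * cf (Suc k) y)" for k
      by (simp add: cfS algebra_simps hh' bs)
  qed (simp_all add: idm_units bs d)
  then have "sse c (flat (companion (idm n) (\<lambda>k. - (h * cf k y')) (Suc d)))"
    by (rule sse_flat_back [OF c])
  moreover have "cf k y' = 0" if "Suc d < k" for k
    using that d by (cases k) (simp_all add: cfS)
  ultimately show ?thesis
    unfolding y'_def [symmetric]
    using h b' by (intro PhiI [where h = h and d = "Suc d"]) (simp_all only: cf0 zero_less_Suc)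
qed

text \<open>The normalizing factor stands on the other side of the transvection, so \<open>u\<close>
  and \<open>w\<close> enter \<open>companion_right\<close> as they are.\<close>

lemma Phi_right:
  assumes y: "Phi n y c" and u: "bounded_by n u" "bounded_by n w" "w * u = 0"
  shows "Phi n (y * (idm n + tau 1 (u * w))) c"
proof -
  obtain h d where h: "bounded_by n h" "h * cf 0 y = idm n" "cf 0 y * h = idm n"
    and d: "0 < d" "\<And>k. d < k \<Longrightarrow> cf k y = 0"
    and b: "bounded_by n y" and c: "sse c (flat (companion (idm n) (\<lambda>k. - (h * cf k y)) d))"
    using y by (rule PhiE) blast
  have bk: "bounded_by n (cf k y)" for k
    using b by (rule bounded_by_cf)
  note bs = bounded_by_intros bounded_by_idm bounded_by_tau h(1) u(1,2) bk b
  define y' where "y' = y * (idm n + tau 1 (u * w))"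
  have b': "bounded_by n y'" unfolding y'_def by (simp add: bs)
  have cf0: "cf 0 y' = cf 0 y"
    by (simp add: y'_def cf_mult_tau distrib_left cf_add idm_units bs)
  have cfS: "cf (Suc k) y' = cf (Suc k) y + cf k y * (u * w)" for k
    by (simp add: y'_def cf_mult_tau distrib_left cf_add idm_units bs)
  have hh: "h * (cf 0 y * x) = x" if "bounded_by n x" for x
    using that h by (metis idm_units(1) mult.assoc)
  have "sse (companion (idm n) (\<lambda>k. - (h * cf k y')) (Suc d)) (companion (idm n) (\<lambda>k. - (h * cf k y)) d)"
  proof (rule companion_right [where u = u and w = w])
    show "- (h * cf 1 y') = - (h * cf 1 y) - u * w"
      by (simp add: cfS algebra_simps hh bs)
    show "- (h * cf (Suc (Suc k)) y') =
      - (h * cf (Suc (Suc k)) y) + - (h * cf (Suc k) y) * u * w" for k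
      by (simp add: cfS algebra_simps)
  qed (simp_all add: idm_units bs d u)
  then have "sse c (flat (companion (idm n) (\<lambda>k. - (h * cf k y')) (Suc d)))"
    by (rule sse_flat_back [OF c])
  moreover have "cf k y' = 0" if "Suc d < k" for k
    using that d by (cases k) (simp_all add: cfS)
  ultimately show ?thesis
    unfolding y'_def [symmetric]
    using h b' by (intro PhiI [where h = h and d = "Suc d"]) (simp_all only: cf0 zero_less_Suc)
qed

lemma Phi_pencil:
  fixes A :: "'r::{ring, monoid_mult} fmat"
  assumes A: "bounded_by n A"
  shows "Phi n (idm n - tau 1 A) A"
proof -
  have "sse A (flat (companion (idm n) (\<lambda>k. - (idm n * cf k (idm n - tau 1 A))) 1))"
    using sse_reidx [OF inj_prod_encode_pair, of A 0] A
    unfolding companion_1 by (simp add: cf_diff cf_tau cf_idm idm_units flat_sg_diag)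
  then show ?thesis
    using A by (intro PhiI [where h = "idm n" and d = 1])
      (simp_all add: cf_diff cf_tau cf_idm idm_units bounded_by_intros bounded_by_idm bounded_by_tau)
qed

text \<open>The witnesses in \<open>Phi\<close> are determined up to the degree bound: the constant
  coefficient of \<open>1 - t A\<close> is the unit, hence so is \<open>h\<close>, and a bound above
  1 is lowered by removing zero coefficients.\<close>

lemma Phi_pencil_D:
  fixes A :: "'r::{ring, monoid_mult} fmat"
  assumes A: "bounded_by n A" and P: "Phi n (idm n - tau 1 A) c"
  shows "sse c A"
proof -
  obtain h d where h: "bounded_by n h" "h * cf 0 (idm n - tau 1 A) = idm n" and d: "0 < d"
    and c: "sse c (flat (companion (idm n) (\<lambda>k. - (h * cf k (idm n - tau 1 A))) d))"
    using P by (rule PhiE) blast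
  have "h = idm n"
    using h by (simp add: cf_diff cf_tau cf_idm idm_units)
  define M where "M k = - (h * cf k (idm n - tau 1 A))" for k
  have M: "M k = (if k = 1 then A else if k = 0 then - idm n else 0)" for k
    using A \<open>h = idm n\<close>
    by (auto simp: M_def cf_diff cf_tau cf_idm idm_units bounded_by_idm)
  have "sse (companion (idm n) M d) (companion (idm n) M 1)"
    using d A by (intro companion_extend_many)
      (auto simp: M idm_units bounded_by_idm)
  then have "sse (flat (companion (idm n) M d)) (flat (sg 0 0 A))"
    by (metis M companion_1 sse_flat)
  then show ?thesis
    using sse_trans [OF sse_trans [OF c] sse_sym [OF sse_reidx [OF inj_prod_encode_pair]]]
    unfolding flat_sg_diag M_def by blast
qed

text \<open>Quantifying over all \<open>y\<close> and both sides makes this set closed under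
  products, so membership need only be checked on generators.\<close>

definition Pres :: "nat \<Rightarrow> 'r::{ring, monoid_mult} npoly fmat set"
  where "Pres n = {x. bounded_by n x \<and> (\<forall>y c. Phi n y c \<longrightarrow> Phi n (x * y) c \<and> Phi n (y * x) c)}"

lemma Pres_mult: "x \<in> Pres n \<Longrightarrow> x' \<in> Pres n \<Longrightarrow> x * x' \<in> Pres n"
  unfolding Pres_def by (auto simp: mult.assoc bounded_by_mult) (simp flip: mult.assoc)

lemma Pres_sg_const:
  assumes "i \<noteq> j" "i < n" "j < n"
  shows "idm n + sg i j (nmonom 0 r) \<in> Pres n"
proof -
  define g where "g = idm n + sg i j r"
  define g' where "g' = idm n - sg i j r"
  have b: "bounded_by n (sg i j x)" for x :: 'a
    using assms by (simp add: bounded_by_sg)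
  have "bounded_by n g" "bounded_by n g'" "g * g' = idm n" "g' * g = idm n"
    using b assms by (auto simp: g_def g'_def bounded_by_intros bounded_by_idm algebra_simps
        idm_units sg_mult_sg)
  moreover have "idm n + sg i j (nmonom 0 r) = tau 0 g"
    by (simp add: g_def tau_add tau_idm tau_sg)
  ultimately show ?thesis
    unfolding Pres_def by (auto intro: Phi_const_left Phi_const_right bounded_by_tau)
qed

lemma Pres_sg_linear:
  assumes "i \<noteq> j" "i < n" "j < n"
  shows "idm n + sg i j (nmonom 1 r) \<in> Pres n"
proof -
  \<comment> \<open>The factorization \<open>r e_ij = e_ii (r e_ij)\<close> in matrix units; the
    product in the other order vanishes because \<open>i\<close> and \<open>j\<close>
    differ.\<close>
  define u where "u = sg i i (1::'a)"
  define w where "w = sg i j r"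
  have "bounded_by n u" "bounded_by n w" "w * u = 0"
    using assms by (auto simp: u_def w_def bounded_by_sg sg_mult_sg)
  moreover have "sg i j (nmonom 1 r) = tau 1 (u * w)"
    by (simp add: u_def w_def tau_sg sg_mult_sg)
  ultimately show ?thesis
    unfolding Pres_def
    by (auto intro!: Phi_left Phi_right bounded_by_tau bounded_by_intros bounded_by_idm
        simp del: One_nat_def)
qed

text \<open>By the commutator formula, the transvection with entry \<open>t a\<close> at
  \<open>(i, j)\<close> is built from entries \<open>t\<close> at \<open>(i, l)\<close> and
  \<open>a\<close> at \<open>(l, j)\<close>. Induction on the polynomial then leaves the constant
  and linear transvections.\<close>

lemma Pres_sg:
  fixes f :: "'r::{ring, monoid_mult} npoly"
  assumes n: "3 \<le> n"
  shows "i \<noteq> j \<Longrightarrow> i < n \<Longrightarrow> j < n \<Longrightarrow> idm n + sg i j f \<in> Pres n"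
proof -
  \<comment> \<open>The negative is carried along because the commutator contains inverses.\<close>
  define P where "P f \<longleftrightarrow> (\<forall>i<n. \<forall>j<n. i \<noteq> j \<longrightarrow>
    idm n + sg i j f \<in> Pres n \<and> idm n + sg i j (- f) \<in> Pres n)" for f :: "'r npoly"
  have "P f"
  proof (induction f rule: npoly_induct)
    case (1 r)
    show ?case
      unfolding P_def by (auto intro: Pres_sg_const simp flip: nmonom_minus)
  next
    case (2 f g)
    have "idm n + sg i j (a + b) \<in> Pres n"
      if "i < n" "j < n" "i \<noteq> j" "idm n + sg i j a \<in> Pres n" "idm n + sg i j b \<in> Pres n"
      for i j and a b :: "'r npoly"
    proof -
      have "idm n + sg i j (a + b) = (idm n + sg i j a) * (idm n + sg i j b)"
        using that by (simp add: algebra_simps idm_units bounded_by_idm bounded_by_sg sg_mult_sg sg_add)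
      then show ?thesis using that by (simp add: Pres_mult)
    qed
    then show ?case
      using 2 unfolding P_def minus_add_distrib by blast
  next
    case (3 g)
    have *: "idm n + sg i j (nmonom 1 1 * a) \<in> Pres n"
      if "i < n" "j < n" "i \<noteq> j" "P a" for i j and a :: "'r npoly"
    proof -
      obtain l where l: "l < n" "l \<noteq> i" "l \<noteq> j"
      proof -
        have "card {i, j} < card {..<n}" using n by (simp add: card_insert_if)
        then have "\<not> {..<n} \<subseteq> {i, j}" by (metis card_mono finite.emptyI finite.insertI leD)
        then show ?thesis using that by blast
      qed
      define A where "A = sg i l (nmonom 1 1 :: 'r npoly)"
      define B where "B = sg l j a"
      have b: "bounded_by n A" "bounded_by n B"
        using l that by (simp_all add: A_def B_def bounded_by_sg)
      have AB: "A * A = 0" "B * B = 0" "B * A = 0" "A * B = sg i j (nmonom 1 1 * a)"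
        using l that by (simp_all add: A_def B_def sg_mult_sg)
      have z: "A * (A * x) = 0" "B * (B * x) = 0" "B * (A * x) = 0" for x
        by (simp_all add: AB flip: mult.assoc)
      \<comment> \<open>A commutator: as \<open>A * A\<close>, \<open>B * B\<close> and
        \<open>B * A\<close> vanish, only \<open>1\<close> and \<open>A * B\<close> survive.\<close>
      have "idm n + sg i j (nmonom 1 1 * a) =
          (idm n + A) * (idm n + B) * (idm n + - A) * (idm n + - B)"
        unfolding AB(4) [symmetric]
        by (simp add: algebra_simps idm_units b bounded_by_idm bounded_by_mult z AB(1-3))
      moreover have "idm n + A \<in> Pres n" "idm n + - A \<in> Pres n"
        using l that Pres_sg_linear [of i l n 1] Pres_sg_linear [of i l n "- 1"]
        by (simp_all add: A_def nmonom_minus sg_minus)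
      moreover have "idm n + B \<in> Pres n" "idm n + - B \<in> Pres n"
        using l that by (auto simp: P_def B_def simp flip: sg_minus)
      ultimately show ?thesis by (simp add: Pres_mult)
    qed
    have g: "P (- g)" using 3 by (simp add: P_def)
    show ?case
      unfolding P_def using * [OF _ _ _ 3] * [OF _ _ _ g] by simp
  qed
  then show "i \<noteq> j \<Longrightarrow> i < n \<Longrightarrow> j < n \<Longrightarrow> idm n + sg i j f \<in> Pres n"
    by (simp add: P_def)
qed

lemma idm_circ:
  "bounded_by n u \<Longrightarrow> bounded_by n v \<Longrightarrow> idm n + circ u v = (idm n + u) * (idm n + v)"
  by (simp add: circ_def algebra_simps idm_units bounded_by_idm)

lemma Pres_idm: "idm n \<in> Pres n"
  by (auto simp: Pres_def Phi_def idm_units bounded_by_idm)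

lemma bounded_by_circ: "bounded_by n u \<Longrightarrow> bounded_by n v \<Longrightarrow> bounded_by n (circ u v)"
  by (simp add: circ_def bounded_by_intros)

lemma Pres_elc:
  assumes "u \<in> elc"
  shows "\<exists>m. \<forall>n\<ge>m. bounded_by n u \<and> idm n + u \<in> Pres n"
  using assms
proof (induction u rule: elc.induct)
  case zero
  then show ?case by (simp add: bounded_by_zero Pres_idm)
next
  case (step u i j x)
  then obtain m where m: "\<And>n. n \<ge> m \<Longrightarrow> bounded_by n u \<and> idm n + u \<in> Pres n" by blast
  \<comment> \<open>The 3 leaves room for the third index in \<open>Pres_sg\<close>; the last bound
    makes both indices of the new factor admissible.\<close>
  show ?case
  proof (intro exI [of _ "max m (max 3 (Suc (max i j)))"] allI impI)
    fix n assume n: "max m (max 3 (Suc (max i j))) \<le> n"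
    then have b: "bounded_by n u" "bounded_by n (sg i j x)"
      using m by (auto intro: bounded_by_sg)
    then show "bounded_by n (circ u (sg i j x)) \<and> idm n + circ u (sg i j x) \<in> Pres n"
      using m n step.hyps by (auto simp: idm_circ bounded_by_circ intro!: Pres_mult Pres_sg)
  qed
qed

text \<open>The equation means \<open>(1 + u) (1 - t B) = (1 - t A) (1 + v)\<close>. In a size
  bounding everything, \<open>1 - t A\<close> arises from \<open>1 - t B\<close> by factors in
  \<open>Pres\<close>, so \<open>Phi\<close> carries \<open>B\<close> over to the pencil of
  \<open>A\<close>.\<close>

lemma elc_equivalent_sse:
  fixes A B :: "'r::{ring, monoid_mult} fmat"
  assumes "circ u (- tau 1 B) = circ (- tau 1 A) v" "u \<in> elc" "v \<in> elc"
  shows "sse A B"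
proof -
  obtain v' where v': "v' \<in> elc" "circ v v' = 0"
    using elc_inverse \<open>v \<in> elc\<close> by blast
  obtain m1 where m1: "\<forall>n\<ge>m1. bounded_by n u \<and> idm n + u \<in> Pres n"
    using Pres_elc assms by blast
  obtain m2 where m2: "\<forall>n\<ge>m2. bounded_by n v' \<and> idm n + v' \<in> Pres n"
    using Pres_elc v' by blast
  obtain m3 where m3: "bounded_by m3 A" "bounded_by m3 B"
    using bounded_by_ex2 by blast
  define n where "n = max m1 (max m2 m3)"
  have n: "bounded_by n u" "idm n + u \<in> Pres n" "bounded_by n v'" "idm n + v' \<in> Pres n"
      "bounded_by n A" "bounded_by n B"
    using m1 m2 m3 by (auto simp: n_def intro: bounded_by_mono)
  have "- tau 1 A = circ (circ u (- tau 1 B)) v'"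
    using assms(1) v' by (simp add: circ_assoc circ_zero)
  then have "idm n - tau 1 A = (idm n + u) * (idm n - tau 1 B) * (idm n + v')"
    using n by (metis (no_types) bounded_by_circ bounded_by_minus bounded_by_tau diff_conv_add_uminus idm_circ)
  moreover have "Phi n (idm n - tau 1 B) B"
    using n by (intro Phi_pencil)
  ultimately have "Phi n (idm n - tau 1 A) B"
    using n unfolding Pres_def by auto
  then show ?thesis
    using Phi_pencil_D n sse_sym by blast
qed

section \<open>Linearization and shift equivalence\<close>

text \<open>No column index is also a row index, so all products of two summands vanish and
  \<open>circ\<close> is plain addition.\<close>

lemma sum_sg_elc:
  assumes "finite S" "\<And>x. x \<in> S \<Longrightarrow> P (fst x) \<and> \<not> P (snd x)"
  shows "(\<Sum>x\<in>S. sg (fst x) (snd x) (f x)) \<in> elc"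
  using assms
proof (induction S)
  case (insert x S)
  have "snd y \<noteq> fst x" if "y \<in> S" for y
    using insert.prems [of x] insert.prems [of y] that by auto
  then have "(\<Sum>y\<in>S. sg (fst y) (snd y) (f y)) * sg (fst x) (snd x) (f x) = 0"
    by (simp add: sum_distrib_right sg_mult_sg)
  then have "(\<Sum>y\<in>insert x S. sg (fst y) (snd y) (f y))
      = circ (\<Sum>y\<in>S. sg (fst y) (snd y) (f y)) (sg (fst x) (snd x) (f x))"
    using insert.hyps by (simp add: circ_def add.commute)
  moreover have "fst x \<noteq> snd x" using insert.prems [of x] by auto
  ultimately show ?case using insert by (simp add: elc.step)
qed (simp add: elc.zero)

lemma off_diagonal_elc:
  assumes "\<And>i j. ent u i j \<noteq> 0 \<Longrightarrow> P i \<and> \<not> P j"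
  shows "u \<in> elc"
proof -
  obtain n where n: "bounded_by n u"
    using bounded_by_ex by blast
  define S where "S = {x \<in> {..<n} \<times> {..<n}. ent u (fst x) (snd x) \<noteq> 0}"
  have S: "finite S" by (simp add: S_def)
  have "u = (\<Sum>x\<in>S. sg (fst x) (snd x) (ent u (fst x) (snd x)))"
  proof (rule fmat_eqI)
    fix i j
    have "(\<Sum>x\<in>S. ent (sg (fst x) (snd x) (ent u (fst x) (snd x))) i j)
        = (\<Sum>x\<in>S. if x = (i, j) then ent u i j else 0)"
      by (intro sum.cong) (auto simp: ent_sg)
    also have "\<dots> = ent u i j"
      using n S by (auto simp: S_def bounded_byD not_less)
    finally show "ent u i j = ent (\<Sum>x\<in>S. sg (fst x) (snd x) (ent u (fst x) (snd x))) i j"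
      by (simp add: ent_sum)
  qed
  also have "\<dots> \<in> elc"
    using S assms by (intro sum_sg_elc [where P = P]) (auto simp: S_def)
  finally show ?thesis .
qed

lemma blk_upper_elc: "blk 0 b 0 0 \<in> elc"
proof (rule off_diagonal_elc [where P = "\<lambda>i. fst (prod_decode i) = 0"])
  fix i j assume *: "ent (blk 0 b 0 0) i j \<noteq> 0"
  obtain k i' l j' where "i = prod_encode (k, i')" "j = prod_encode (l, j')"
    by (metis prod_decode_inverse surj_pair)
  with * show "fst (prod_decode i) = 0 \<and> fst (prod_decode j) \<noteq> 0"
    by (simp add: ent_blk ent_zero split: if_splits)
qed

lemma blk_lower_elc: "blk 0 0 c 0 \<in> elc"
proof (rule off_diagonal_elc [where P = "\<lambda>i. fst (prod_decode i) = 1"])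
  fix i j assume *: "ent (blk 0 0 c 0) i j \<noteq> 0"
  obtain k i' l j' where "i = prod_encode (k, i')" "j = prod_encode (l, j')"
    by (metis prod_decode_inverse surj_pair)
  with * show "fst (prod_decode i) = 1 \<and> fst (prod_decode j) \<noteq> 1"
    by (simp add: ent_blk ent_zero split: if_splits)
qed

section \<open>Reindexing of elementary matrices\<close>

lemma reidx_add:
  assumes "inj f"
  shows "reidx f (a + b) = reidx f a + reidx f b"
  using assms by (intro reidx_eqI) (auto simp: ent_add ent_reidx ent_reidx_0)

lemma reidx_mult:
  assumes f: "inj f"
  shows "reidx f (a * b) = reidx f a * reidx f b"
proof (rule reidx_eqI [OF f])
  obtain n where n: "bounded_by n a"
    using bounded_by_ex by blast
  fix i j
  have "ent (reidx f a * reidx f b) (f i) (f j)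
      = (\<Sum>x\<in>f ` {..<n}. ent (reidx f a) (f i) x * ent (reidx f b) x (f j))"
  proof (rule ent_mult_on)
    fix x assume x: "x \<notin> f ` {..<n}"
    show "ent (reidx f a) (f i) x = 0 \<or> ent (reidx f b) x (f j) = 0"
    proof (cases "x \<in> range f")
      case True
      then obtain y where "x = f y" "n \<le> y" using x by fastforce
      then show ?thesis using n f by (simp add: ent_reidx bounded_byD)
    next
      case False
      then show ?thesis using f by (simp add: ent_reidx_0)
    qed
  qed simp
  also have "\<dots> = ent (a * b) i j"
    using f n by (subst sum.reindex) (auto simp: ent_reidx ent_mult [of n] intro: inj_on_subset)
  finally show "ent (reidx f a * reidx f b) (f i) (f j) = ent (a * b) i j" .
next
  fix i j assume "i \<notin> range f \<or> j \<notin> range f"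
  then show "ent (reidx f a * reidx f b) i j = 0"
    using f by (subst ent_mult_on [where K = "{}"]) (auto simp: ent_reidx_0 ent_reidx')
qed

lemma reidx_sg: "inj f \<Longrightarrow> reidx f (sg i j x) = sg (f i) (f j) x"
  by (intro reidx_eqI) (auto simp: ent_sg dest: injD)

lemma reidx_zero: "inj f \<Longrightarrow> reidx f 0 = 0"
  by (intro reidx_eqI) (auto simp: ent_zero)

lemma reidx_elc:
  assumes f: "inj f"
  shows "u \<in> elc \<Longrightarrow> reidx f u \<in> elc"
proof (induction u rule: elc.induct)
  case (step u i j x)
  then show ?case
    using elc.step [of "reidx f u" "f i" "f j" x] f
    by (auto simp: circ_def reidx_add reidx_mult reidx_sg dest: injD)
qed (simp add: elc.zero reidx_zero f)

text \<open>Each new value is corrected by a transposition, which leaves the earlier values alone by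
  injectivity.\<close>

lemma ex_bij_extending:
  fixes f :: "'a \<Rightarrow> 'a"
  assumes "finite S" "inj_on f S"
  shows "\<exists>g. bij g \<and> (\<forall>x\<in>S. g x = f x)"
  using assms
proof (induction S)
  case empty
  show ?case by (intro exI [of _ id]) (simp add: bij_def)
next
  case (insert x S)
  then obtain g where g: "bij g" "\<And>y. y \<in> S \<Longrightarrow> g y = f y" by auto
  define h where "h = transpose (g x) (f x) \<circ> g"
  have "bij h" using g by (simp add: h_def bij_comp)
  moreover have "h y = f y" if "y \<in> S" for y
  proof -
    have "f y \<noteq> f x" using insert that by (auto simp: inj_on_def)
    moreover have "g y \<noteq> g x" using insert.hyps that g(1) by (metis bij_is_inj injD)
    ultimately show ?thesis using g(2) [OF that] by (simp add: h_def transpose_def)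
  qed
  ultimately show ?case by (auto simp: h_def)
qed

text \<open>An injection need not be invertible, but on the finite support of \<open>u\<close> it
  agrees with a bijection, and reindexing by the inverse of that bijection recovers
  \<open>u\<close>.\<close>

lemma reidx_elc_D:
  assumes f: "inj f" and "reidx f u \<in> elc"
  shows "u \<in> elc"
proof -
  obtain n where n: "bounded_by n u"
    using bounded_by_ex by blast
  obtain g where g: "bij g" "\<And>i. i < n \<Longrightarrow> g i = f i"
    using ex_bij_extending [of "{..<n}" f] inj_on_subset [OF f] by auto
  define h where "h = the_inv g"
  have h: "bij h" "\<And>i. h (g i) = i" "\<And>i. g (h i) = i"
    using g(1) by (auto simp: h_def bij_betw_the_inv_into the_inv_f_f bij_is_inj
        f_the_inv_into_f_bij_betw)
  have "reidx h (reidx f u) = u"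
  proof (rule reidx_eqI)
    fix i j
    show "ent u (h i) (h j) = ent (reidx f u) i j"
    proof (cases "h i < n \<and> h j < n")
      case True
      then show ?thesis using ent_reidx [OF f] g h by metis
    next
      case False
      have "ent (reidx f u) i j = 0"
      proof (cases "i \<in> range f \<and> j \<in> range f")
        case True
        then obtain i' j' where *: "i = f i'" "j = f j'" by auto
        then have "\<not> (i' < n \<and> j' < n)"
          using False g h by metis
        then show ?thesis
          using n by (auto simp: * ent_reidx f bounded_byD not_less)
      next
        case False
        then show ?thesis using f by (intro ent_reidx_0) auto
      qed
      then show ?thesis
        using n False by (auto simp: bounded_byD not_less)
    qed
  qed (use h(1) in \<open>auto simp: bij_is_inj bij_is_surj\<close>)
  then show ?thesis
    using reidx_elc [OF bij_is_inj [OF h(1)] assms(2)] by simp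
qed

section \<open>Evaluation at \<open>t = 0\<close>, constant matrices and invertibility\<close>

lemma cf_0_circ: "cf 0 (circ u v) = circ (cf 0 u) (cf 0 v)"
  by (simp add: circ_def cf_add cf_0_mult)

lemma cf_0_elc: "u \<in> elc \<Longrightarrow> cf 0 u \<in> elc"
proof (induction u rule: elc.induct)
  case (step u i j x)
  have "cf 0 (sg i j x) = sg i j (npoly_coeff x 0)"
    by (simp add: cf_def fmap_sg npoly_coeff_zero)
  then show ?case
    using step by (simp add: cf_0_circ elc.step)
qed (simp add: elc.zero cf_zero)

lemma tau_0_elc: "u \<in> elc \<Longrightarrow> tau 0 u \<in> elc"
proof (induction u rule: elc.induct)
  case (step u i j x)
  have "tau 0 (circ u (sg i j x)) = circ (tau 0 u) (sg i j (nmonom 0 x))"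
    by (simp add: circ_def tau_add tau_sg flip: tau_mult [of 0 _ 0, simplified])
  then show ?case
    using step by (simp add: elc.step)
qed (simp add: elc.zero tau_zero)

text \<open>Quasi-invertibility of \<open>u\<close>, that is, invertibility of
  \<open>1 + u\<close>.\<close>

definition cinv :: "'a::ring \<Rightarrow> bool"
  where "cinv u \<longleftrightarrow> (\<exists>v. circ u v = 0 \<and> circ v u = 0)"

lemma cinv_circ:
  assumes "cinv u" "cinv v"
  shows "cinv (circ u v)"
proof -
  obtain u' v' where *: "circ u u' = 0" "circ u' u = 0" "circ v v' = 0" "circ v' v = 0"
    using assms unfolding cinv_def by blast
  have "circ (circ u v) (circ v' u') = circ u (circ (circ v v') u')"
    "circ (circ v' u') (circ u v) = circ v' (circ (circ u' u) v)"
    by (simp_all add: circ_assoc)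
  then show ?thesis
    unfolding cinv_def using * by (metis circ_zero(2))
qed

lemma elc_cinv: "u \<in> elc \<Longrightarrow> cinv u"
  using elc_inverse unfolding cinv_def by blast

lemma cinv_blk: "cinv u \<Longrightarrow> cinv (blk u 0 0 0)"
  unfolding cinv_def
proof (elim exE conjE)
  fix v assume "circ u v = 0" "circ v u = 0"
  then have "circ (blk u 0 0 0) (blk v 0 0 0) = 0 \<and> circ (blk v 0 0 0) (blk u 0 0 0) = 0"
    by (simp add: circ_def blk_add blk_mult blk_zero)
  then show "\<exists>v. circ (blk u 0 0 0) v = 0 \<and> circ v (blk u 0 0 0) = 0" by blast
qed

text \<open>The matrix with blocks \<open>1\<close>, \<open>t r\<close>, \<open>s\<close>, \<open>1\<close> is elementarily equivalent both to
  \<open>(1 - t r s) \<oplus> 1\<close> and to \<open>1 \<oplus> (1 - t s r)\<close>.\<close>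

lemma elc_swap:
  assumes "- tau 1 (r * s) \<in> elc"
  shows "- tau 1 (s * r) \<in> elc"
proof -
  define a where "a = tau 1 r"
  define b where "b = tau 0 s"
  have ab: "a * b = tau 1 (r * s)" "b * a = tau 1 (s * r)"
    by (simp_all add: a_def b_def tau_mult)
  have "blk (- (a * b)) 0 0 0 \<in> elc"
    unfolding blk_first using assms by (intro reidx_elc inj_prod_encode_pair) (simp add: ab)
  then have "circ (blk 0 a 0 0) (circ (blk (- (a * b)) 0 0 0) (blk 0 0 b 0)) \<in> elc"
    by (intro elc_circ blk_upper_elc blk_lower_elc)
  also have "circ (blk 0 a 0 0) (circ (blk (- (a * b)) 0 0 0) (blk 0 0 b 0)) = blk 0 a b 0"
    by (simp add: circ_def blk_add blk_mult)
  finally have "circ (blk 0 0 (- b) 0) (circ (blk 0 a b 0) (blk 0 (- a) 0 0)) \<in> elc"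
    by (intro elc_circ blk_upper_elc blk_lower_elc)
  also have "circ (blk 0 0 (- b) 0) (circ (blk 0 a b 0) (blk 0 (- a) 0 0)) = blk 0 0 0 (- (b * a))"
    by (simp add: circ_def blk_add blk_mult)
  finally show ?thesis
    unfolding blk_last ab by (rule reidx_elc_D [OF inj_prod_encode_pair])
qed

lemma sse_elc:
  assumes "sse a b" "- tau 1 a \<in> elc"
  shows "- tau 1 b \<in> elc"
  using assms
proof (induction rule: rtranclp_induct)
  case (step b c)
  then show ?case
    unfolding esse_def using elc_swap by blast
qed
text \<open>If the constant coefficient of \<open>u\<close> is zero, \<open>v\<close> is
  \<open>(u - t u_1) / t\<close>, with \<open>u_1\<close> the linear coefficient: the part that
  Higman's trick splits off.\<close>

lemma ex_shift:
  fixes u :: "'r::{ring, monoid_mult} npoly fmat"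
  shows "\<exists>v. cf 0 v = 0 \<and> (\<forall>k. cf (Suc k) v = cf (Suc (Suc k)) u)"
proof -
  define P where "P f g \<longleftrightarrow> npoly_coeff g 0 = 0 \<and> (\<forall>k. npoly_coeff g (Suc k) = npoly_coeff f (Suc (Suc k)))"
    for f g :: "'r npoly"
  have ex: "\<exists>g. P f g" for f
  proof -
    obtain g where g: "\<And>k. npoly_coeff g k = npoly_coeff f (Suc k)"
      using ex_npoly_shift by blast
    obtain h where h: "\<And>k. npoly_coeff h k = npoly_coeff g (Suc k)"
      using ex_npoly_shift by blast
    show ?thesis
      by (rule exI [of _ "nmonom 1 1 * h"]) (simp add: P_def npoly_coeff_nmonom_mult h g)
  qed
  define s where "s f = (SOME g. P f g)" for f
  have s: "P f (s f)" for f
    unfolding s_def using ex by (rule someI_ex)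
  \<comment> \<open>\<open>fmap\<close> acts entrywise only for maps that fix 0, so the chosen
    \<open>s\<close> has to be determined at 0.\<close>
  have s0: "s 0 = 0"
  proof (rule npoly_eqI)
    show "npoly_coeff (s 0) n = npoly_coeff 0 n" for n
      using s [of 0] by (cases n) (auto simp: P_def npoly_coeff_zero)
  qed
  have "cf 0 (fmap s u) = 0 \<and> (\<forall>k. cf (Suc k) (fmap s u) = cf (Suc (Suc k)) u)"
    using s by (auto intro!: fmat_eqI simp: ent_cf ent_fmap s0 P_def ent_zero)
  then show ?thesis by blast
qed

text \<open>Higman's trick: moving a factor \<open>t\<close> of the terms of degree at least two into a second block
  lowers the degree.\<close>

lemma cinv_linearize:
  fixes u :: "'r::{ring, monoid_mult} npoly fmat"
  assumes linear: "\<And>N :: 'r fmat. cinv (- tau 1 N) \<Longrightarrow> - tau 1 N \<in> elc"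
  shows "cf 0 u = 0 \<Longrightarrow> (\<And>k. Suc d < k \<Longrightarrow> cf k u = 0) \<Longrightarrow> cinv u \<Longrightarrow> u \<in> elc"
proof (induction d arbitrary: u)
  case 0
  have "u = - tau 1 (- cf 1 u)"
  proof (rule cf_eqI)
    show "cf k u = cf k (- tau 1 (- cf 1 u))" for k
      using 0(1) 0(2) [of k] by (cases "k = 0 \<or> k = 1") (auto simp: cf_minus cf_tau)
  qed
  then show ?case using linear 0(3) by metis
next
  case (Suc d)
  obtain v where v: "cf 0 v = 0" "\<And>k. cf (Suc k) v = cf (Suc (Suc k)) u"
    using ex_shift by blast
  obtain n where n: "bounded_by n u" "bounded_by n v"
    using bounded_by_ex2 by blast
  \<comment> \<open>The indeterminate times the identity of a size that contains \<open>u\<close>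
    and \<open>v\<close>.\<close>
  define t :: "'r npoly fmat" where "t = tau 1 (idm n)"
  have u: "u = tau 1 (cf 1 u) + v * t"
  proof (rule cf_eqI)
    show "cf k u = cf k (tau 1 (cf 1 u) + v * t)" for k
    proof (cases "k = 0 \<or> k = 1")
      case True
      then show ?thesis using Suc.prems(1) v by (auto simp: t_def cf_add cf_tau cf_mult_tau)
    next
      case False
      then obtain l where "k = Suc (Suc l)" by (metis One_nat_def not0_implies_Suc)
      then show ?thesis
        using n v by (simp add: t_def cf_add cf_tau cf_mult_tau idm_units bounded_by_cf)
    qed
  qed
  \<comment> \<open>With the ones restored, the blocks are \<open>1 + t u_1\<close>,
    \<open>v\<close>, \<open>- t\<close>, \<open>1\<close>: the transvections by \<open>v\<close>
    and \<open>- t\<close> have removed \<open>v t\<close> from the first block. As \<open>v\<close>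
    has no constant term, \<open>u'\<close> still vanishes at \<open>t = 0\<close>, and the degree
    bound drops by one.\<close>
  define u' where "u' = blk (tau 1 (cf 1 u)) v (- t) 0"
  have u': "u' = circ (blk 0 v 0 0) (circ (blk u 0 0 0) (blk 0 0 (- t) 0))"
    by (subst u) (simp add: u'_def circ_def blk_add blk_mult)
  have "cinv u'"
    unfolding u' by (intro cinv_circ cinv_blk Suc.prems elc_cinv blk_upper_elc blk_lower_elc)
  moreover have "cf 0 u' = 0"
    by (simp add: u'_def cf_blk cf_tau cf_minus cf_zero v t_def blk_zero)
  moreover have "cf k u' = 0" if "Suc d < k" for k
  proof -
    obtain l where k: "k = Suc l" "0 < l" using \<open>Suc d < k\<close> by (cases k) auto
    have "cf k v = 0" using that Suc.prems(2) [of "Suc k"] by (simp add: v k)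
    then show ?thesis
      using k by (simp add: u'_def cf_blk cf_tau cf_minus cf_zero t_def blk_zero)
  qed
  ultimately have "u' \<in> elc" by (intro Suc.IH)
  then have "circ (blk 0 (- v) 0 0) (circ u' (blk 0 0 t 0)) \<in> elc"
    by (intro elc_circ blk_upper_elc blk_lower_elc)
  also have "circ (blk 0 (- v) 0 0) (circ u' (blk 0 0 t 0)) = blk u 0 0 0"
    by (subst u) (simp add: u'_def circ_def blk_add blk_mult)
  finally show ?case
    unfolding blk_first by (rule reidx_elc_D [OF inj_prod_encode_pair])
qed

text \<open>The power \<open>a ^ (k + 1)\<close>, which needs no unit.\<close>

primrec pw :: "'a::times \<Rightarrow> nat \<Rightarrow> 'a" where
  "pw a 0 = a"
| "pw a (Suc k) = pw a k * a"

lemma pw_comm: "a * r = r * b \<Longrightarrow> pw a k * r = r * pw b k" for a :: "'a::semigroup_mult"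
  by (induction k) (simp_all add: mult.assoc, metis mult.assoc)

lemma pw_Suc: "pw a (Suc k) = a * pw a k" for a :: "'a::semigroup_mult"
  by (simp add: pw_comm)

lemma pw_add: "pw a (Suc (j + k)) = pw a j * pw a k" for a :: "'a::semigroup_mult"
  by (induction k) (simp_all add: mult.assoc)

text \<open>The inverse of \<open>1 - t N\<close> can only be the geometric series in
  \<open>t N\<close>. Its coefficients are the powers of \<open>N\<close>, and a polynomial has only
  finitely many nonzero ones.\<close>

lemma cinv_nilpotent:
  assumes "cinv (- tau 1 N)"
  shows "\<exists>k. pw N k = 0"
proof -
  obtain v where v: "circ (- tau 1 N) v = 0"
    using assms unfolding cinv_def by blast
  have e: "cf k v = cf k (tau 1 N) + cf k (tau 1 N * v)" for k
  proof -
    have "v = tau 1 N + tau 1 N * v"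
      using v by (simp add: circ_def algebra_simps)
    then show ?thesis by (metis cf_add)
  qed
  have "cf (Suc k) v = pw N k" for k
  proof (induction k)
    case 0
    show ?case using e [of 0] e [of 1] by (simp add: cf_tau cf_tau_mult)
  next
    case (Suc k)
    show ?case using e [of "Suc (Suc k)"] Suc by (simp add: cf_tau cf_tau_mult pw_Suc del: pw.simps)
  qed
  then show ?thesis
    using cf_bound [of v] by (metis le_SucI order.refl)
qed

section \<open>Shift equivalence and geometric sums\<close>

definition se :: "'a::times \<Rightarrow> 'a \<Rightarrow> bool"
  where "se a b \<longleftrightarrow> (\<exists>r s k. pw a k = r * s \<and> pw b k = s * r \<and> a * r = r * b \<and> s * a = b * s)"

text \<open>Compose the maps and add the lags: \<open>pw a k\<close> has exponent
  \<open>k + 1\<close>, so the lags \<open>k + 1\<close> and \<open>k' + 1\<close> add up to the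
  exponent of \<open>pw a (Suc (k' + k))\<close>.\<close>

lemma se_trans:
  fixes a b c :: "'a::semigroup_mult"
  assumes "se a b" "se b c"
  shows "se a c"
proof -
  obtain r s k where 1: "pw a k = r * s" "pw b k = s * r" "a * r = r * b" "s * a = b * s"
    using assms(1) unfolding se_def by blast
  obtain r' s' k' where 2: "pw b k' = r' * s'" "pw c k' = s' * r'" "b * r' = r' * c" "s' * b = c * s'"
    using assms(2) unfolding se_def by blast
  show ?thesis
    unfolding se_def
  proof (intro exI conjI)
    have "pw a (Suc (k' + k)) = pw a k' * r * s" by (simp add: pw_add 1 mult.assoc del: pw.simps)
    also have "\<dots> = r * r' * (s' * s)" by (simp add: pw_comm [OF 1(3)] 2 mult.assoc)
    finally show "pw a (Suc (k' + k)) = r * r' * (s' * s)" .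
    have "pw c (Suc (k' + k)) = s' * r' * pw c k" by (simp add: pw_add 2 del: pw.simps)
    also have "\<dots> = s' * (pw b k * r')" by (simp add: pw_comm [OF 2(3)] mult.assoc)
    also have "\<dots> = s' * s * (r * r')" by (simp add: 1 mult.assoc)
    finally show "pw c (Suc (k' + k)) = s' * s * (r * r')" .
    show "a * (r * r') = r * r' * c" by (metis 1(3) 2(3) mult.assoc)
    show "s' * s * a = c * (s' * s)" by (metis 1(4) 2(4) mult.assoc)
  qed
qed

lemma sse_se:
  fixes a b :: "'r::{ring, monoid_mult} fmat"
  assumes "sse a b"
  shows "se a b"
  using assms
proof induction
  case base
  obtain n where "bounded_by n a"
    using bounded_by_ex by blast
  then show ?case
    unfolding se_def by (intro exI [of _ "idm n"] exI [of _ a] exI [of _ 0]) (simp add: idm_units)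
next
  case (step b c)
  then obtain r s where "b = r * s" "c = s * r" by (auto simp: esse_def)
  then have "se b c"
    unfolding se_def by (intro exI [of _ r] exI [of _ s] exI [of _ 0]) (simp add: mult.assoc)
  with step.IH show ?case by (rule se_trans)
qed

text \<open>\<open>1 + geo a k\<close> is the truncated geometric series
  \<open>1 + t a + ... + t ^ k a ^ k\<close>, an inverse of \<open>1 - t a\<close> up to the term in
  \<open>t ^ (k + 1)\<close>.\<close>

definition geo :: "'a::ring fmat \<Rightarrow> nat \<Rightarrow> 'a npoly fmat"
  where "geo a k = (\<Sum>i<k. tau (Suc i) (pw a i))"

lemma geo_0: "geo a 0 = 0"
  and geo_Suc: "geo a (Suc k) = geo a k + tau (Suc k) (pw a k)"
  by (simp_all add: geo_def)

lemma geo_right: "circ (- tau 1 a) (geo a k) = - tau (Suc k) (pw a k)"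
proof (induction k)
  case (Suc k)
  have "circ (- tau 1 a) (geo a (Suc k))
      = circ (- tau 1 a) (geo a k) + tau (Suc k) (pw a k) - tau 1 a * tau (Suc k) (pw a k)"
    by (simp add: circ_def geo_Suc algebra_simps)
  then show ?case using Suc by (simp add: tau_mult pw_Suc del: pw.simps)
qed (simp add: geo_0 circ_zero)

lemma geo_left: "circ (geo a k) (- tau 1 a) = - tau (Suc k) (pw a k)"
proof (induction k)
  case (Suc k)
  have "circ (geo a (Suc k)) (- tau 1 a)
      = circ (geo a k) (- tau 1 a) + tau (Suc k) (pw a k) - tau (Suc k) (pw a k) * tau 1 a"
    by (simp add: circ_def geo_Suc algebra_simps)
  then show ?case using Suc by (simp add: tau_mult)
qed (simp add: geo_0 circ_zero)

lemma geo_comm: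
  assumes "a * r = r * b"
  shows "geo a k * tau j r = tau j r * geo b k"
  by (induction k) (simp_all add: geo_0 geo_Suc distrib_left distrib_right tau_mult
      pw_comm [OF assms] add.commute)

lemma cf_0_geo: "cf 0 (geo a k) = 0"
  by (induction k) (simp_all add: geo_0 geo_Suc cf_zero cf_add cf_tau)

text \<open>A shift equivalence of lag \<open>k + 1\<close> makes \<open>1 - ta\<close> and \<open>1 - tb\<close> chain homotopy equivalent
  as complexes of length one: the maps are \<open>r\<close> and \<open>t ^ (k + 1) s\<close>, and the homotopies are the
  geometric sums. The matrix \<open>u\<close> below is the resulting stable equivalence.\<close>

lemma se_sse:
  fixes a b :: "'r::{ring, monoid_mult} fmat"
  assumes NK: "\<And>u :: 'r npoly fmat. cinv u \<Longrightarrow> cf 0 u \<in> elc \<Longrightarrow> u \<in> elc" and "se a b"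
  shows "sse a b"
proof -
  obtain r s k where se: "pw a k = r * s" "pw b k = s * r" "a * r = r * b" "s * a = b * s"
    using assms(2) unfolding se_def by blast
  define R where "R = tau 0 r"
  define S where "S = tau (Suc k) s"
  define A where "A = tau 1 a"
  define B where "B = tau 1 b"
  define f where "f = geo a k"
  define g where "g = geo b k"
  have RS: "R * S = tau (Suc k) (pw a k)" "S * R = tau (Suc k) (pw b k)"
    "A * R = R * B" "S * A = B * S" "f * R = R * g" "S * f = g * S"
    using se by (simp_all add: R_def S_def A_def B_def tau_mult f_def g_def geo_comm [OF se(3)]
        geo_comm [OF se(4) [symmetric]])
  have fg: "A * f = f - A + R * S" "f * A = f - A + R * S" "B * g = g - B + S * R" "g * B = g - B + S * R"
    using geo_left [of a k] geo_right [of a k] geo_left [of b k] geo_right [of b k]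
    unfolding RS A_def [symmetric] B_def [symmetric] f_def [symmetric] g_def [symmetric]
    by (auto simp: circ_def algebra_simps)
  \<comment> \<open>With the ones restored, \<open>u\<close> has blocks \<open>1 - A\<close>,
    \<open>R\<close>, \<open>- S\<close>, \<open>1 + g\<close>, and \<open>u'\<close> has
    \<open>1 + f\<close>, \<open>- R\<close>, \<open>S\<close>, \<open>1 - B\<close>. They are
    inverse to each other: the defect of the geometric sum in each diagonal block is exactly
    \<open>R * S\<close> or \<open>S * R\<close>.\<close>
  define u where "u = blk (- A) R (- S) g"
  define u' where "u' = blk f (- R) S (- B)"
  have "circ u u' = 0" "circ u' u = 0"
    by (simp_all add: u_def u'_def circ_def blk_mult blk_add RS(3-) fg blk_zero algebra_simps)
  then have "cinv u" unfolding cinv_def by blast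
  \<comment> \<open>The factor \<open>t ^ (k + 1)\<close> sits in \<open>S\<close> and not in
    \<open>R\<close>, so at \<open>t = 0\<close> a single triangular block remains, which is
    elementary.\<close>
  moreover have "cf 0 u = blk 0 r 0 0"
    by (simp add: u_def cf_blk R_def S_def A_def g_def cf_minus cf_tau cf_0_geo)
  ultimately have "u \<in> elc"
    using NK blk_upper_elc by metis
  moreover have "circ (blk 0 0 (- S) 0) (blk 0 R 0 0) \<in> elc"
    by (intro elc_circ blk_upper_elc blk_lower_elc)
  \<comment> \<open>Columns are compared using \<open>R (1 - B) = (1 - A) R\<close> and
    \<open>(1 + g) (1 - B) = 1 - S R\<close>.\<close>
  moreover have "circ u (- tau 1 (blk 0 0 0 b)) =
      circ (- tau 1 (blk a 0 0 0)) (circ (blk 0 0 (- S) 0) (blk 0 R 0 0))"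
    unfolding tau_blk tau_zero A_def [symmetric] B_def [symmetric]
    by (simp add: u_def circ_def blk_minus blk_mult blk_add RS(3-) fg algebra_simps)
  ultimately have "sse (blk a 0 0 0) (blk 0 0 0 b)"
    using elc_equivalent_sse by blast
  moreover have "sse a (blk a 0 0 0)" "sse b (blk 0 0 0 b)"
    unfolding blk_first blk_last by (intro sse_reidx inj_prod_encode_pair)+
  ultimately show ?thesis
    using sse_sym sse_trans by blast
qed

section \<open>Matrices of fixed size\<close>

definition pad :: "'a::zero mat \<Rightarrow> 'a fmat"
  where "pad A = fm (max (dim_row A) (dim_col A))
    (\<lambda>i j. if i < dim_row A \<and> j < dim_col A then A $$ (i, j) else 0)"

lemma ent_pad: "ent (pad A) i j = (if i < dim_row A \<and> j < dim_col A then A $$ (i, j) else 0)"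
  by (auto simp: pad_def ent_fm)

definition truncate :: "nat \<Rightarrow> nat \<Rightarrow> 'a::zero fmat \<Rightarrow> 'a mat"
  where "truncate m n a = mat m n (\<lambda>(i, j). ent a i j)"

lemma truncate_carrier: "truncate m n a \<in> carrier_mat m n"
  by (simp add: truncate_def)

lemma pad_truncate:
  assumes "\<And>i j. m \<le> i \<or> n \<le> j \<Longrightarrow> ent a i j = 0"
  shows "pad (truncate m n a) = a"
  using assms by (intro fmat_eqI) (auto simp: ent_pad truncate_def not_less)

lemma pad_truncate_square: "bounded_by n a \<Longrightarrow> pad (truncate n n a) = a"
  by (rule pad_truncate) (auto dest: bounded_byD)

lemma truncate_pad: "A \<in> carrier_mat m n \<Longrightarrow> truncate m n (pad A) = A"
  by (auto simp: truncate_def ent_pad)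

lemma pad_inject: "A \<in> carrier_mat m n \<Longrightarrow> B \<in> carrier_mat m n \<Longrightarrow> pad A = pad B \<Longrightarrow> A = B"
  by (metis truncate_pad)

lemma pad_eqI: "dim_row A = dim_row B \<Longrightarrow> dim_col A = dim_col B \<Longrightarrow> pad A = pad B \<Longrightarrow> A = B"
  by (rule pad_inject [of _ "dim_row A" "dim_col A"]) auto

lemma bounded_by_pad: "A \<in> carrier_mat n n \<Longrightarrow> bounded_by n (pad A)"
  by (auto simp: bounded_by_def ent_pad)

lemma pad_mult:
  fixes A B :: "'a::ring mat"
  assumes "dim_col A = dim_row B"
  shows "pad (A * B) = pad A * pad B"
proof (rule fmat_eqI)
  show "ent (pad (A * B)) i j = ent (pad A * pad B) i j" for i j
    using assms by (subst ent_mult_on [where K = "{0..<dim_row B}"])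
      (auto simp: ent_pad scalar_prod_def intro!: sum.neutral)
qed

lemma pad_one: "pad (1\<^sub>m n) = (idm n :: 'a::{ring, monoid_mult} fmat)"
  by (rule fmat_eqI) (auto simp: ent_pad ent_idm)

lemma idm_pad:
  fixes A :: "'a::{ring, monoid_mult} mat"
  assumes "A \<in> carrier_mat m n"
  shows "idm m * pad A = pad A" "pad A * idm n = pad A"
  using assms by (auto intro!: idm_mult mult_idm simp: ent_pad)

lemma mat_power_carrier: "A \<in> carrier_mat n n \<Longrightarrow> mat_power A k \<in> carrier_mat n n"
  by (induction k) auto

lemma pad_mat_power:
  assumes A: "A \<in> carrier_mat n n"
  shows "pad (mat_power A (Suc k)) = pw (pad A) k"
proof (induction k)
  case 0
  show ?case using A by (simp add: pad_mult pad_one idm_pad)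
next
  case (Suc k)
  have "dim_col (mat_power A (Suc k)) = dim_row A"
    using mat_power_carrier [OF A, of "Suc k"] A by (metis carrier_matD)
  then show ?case
    by (subst mat_power.simps(2), subst pad_mult) (simp_all only: Suc pw.simps)
qed

text \<open>The ring elements \<open>r\<close> and \<open>s\<close> may reach beyond the sizes of
  \<open>A\<close> and \<open>B\<close>. The elements \<open>a * r = r * b\<close> and
  \<open>s * a = b * s\<close> do not: one factor bounds the rows, the other the columns. They give
  a shift equivalence of larger lag.\<close>

lemma shift_equivalent_iff_se:
  fixes A B :: "'r::{ring, monoid_mult} mat"
  assumes A: "A \<in> carrier_mat m m" "0 < m" and B: "B \<in> carrier_mat n n" "0 < n"
  shows "shift_equivalent A B \<longleftrightarrow> se (pad A) (pad B)"
proof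
  assume "shift_equivalent A B"
  then obtain m' n' R S l where *: "A \<in> carrier_mat m' m'" "B \<in> carrier_mat n' n'"
      "R \<in> carrier_mat m' n'" "S \<in> carrier_mat n' m'" "0 < l"
      "mat_power A l = R * S" "mat_power B l = S * R" "A * R = R * B" "S * A = B * S"
    unfolding shift_equivalent_def by blast
  obtain k where k: "l = Suc k" using *(5) by (cases l) auto
  have "pw (pad A) k = pad R * pad S" "pw (pad B) k = pad S * pad R"
    using pad_mat_power [OF *(1), of k] pad_mat_power [OF *(2), of k] *
    by (simp_all add: pad_mult k del: mat_power.simps)
  moreover have "pad A * pad R = pad R * pad B" "pad S * pad A = pad B * pad S"
    using * by (simp_all flip: pad_mult)
  ultimately show "se (pad A) (pad B)"
    unfolding se_def by blast
next
  define a where "a = pad A"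
  define b where "b = pad B"
  assume "se (pad A) (pad B)"
  then obtain r s k where *: "pw a k = r * s" "pw b k = s * r" "a * r = r * b" "s * a = b * s"
    unfolding se_def a_def b_def by blast
  have ab: "bounded_by m a" "bounded_by n b"
    using A B by (simp_all add: a_def b_def bounded_by_pad)
  define R where "R = truncate m n (a * r)"
  define S where "S = truncate n m (s * a)"
  have R: "R \<in> carrier_mat m n" and S: "S \<in> carrier_mat n m"
    by (simp_all add: R_def S_def truncate_carrier)
  have zr: "ent (a * x) i j = 0" if "m \<le> i" for x i j
    using ab that by (subst ent_mult_on [where K = "{}"]) (auto simp: bounded_byD)
  have zr': "ent (b * x) i j = 0" if "n \<le> i" for x i j
    using ab that by (subst ent_mult_on [where K = "{}"]) (auto simp: bounded_byD)
  have zc: "ent (x * a) i j = 0" if "m \<le> j" for x i j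
    using ab that by (subst ent_mult_on [where K = "{}"]) (auto simp: bounded_byD)
  have zc': "ent (x * b) i j = 0" if "n \<le> j" for x i j
    using ab that by (subst ent_mult_on [where K = "{}"]) (auto simp: bounded_byD)
  have pR: "pad R = a * r"
    unfolding R_def by (rule pad_truncate) (metis *(3) zr zc')
  have pS: "pad S = s * a"
    unfolding S_def by (rule pad_truncate) (metis *(4) zr' zc)
  \<comment> \<open>Each of the two added factors \<open>a\<close> raises the exponent by one, from
    \<open>k + 1\<close> to \<open>k + 3\<close>.\<close>
  have "a * r * (s * a) = pw a (Suc (Suc k))"
  proof -
    have "a * r * (s * a) = a * pw a k * a" by (simp add: *(1) mult.assoc)
    then show ?thesis by (metis pw.simps(2) pw_Suc)
  qed
  moreover have "s * a * (a * r) = pw b (Suc (Suc k))"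
  proof -
    have "s * a * (a * r) = b * pw b k * b" by (simp add: * mult.assoc)
    then show ?thesis by (metis pw.simps(2) pw_Suc)
  qed
  ultimately have "pad (mat_power A (Suc (Suc (Suc k)))) = pad (R * S)"
    "pad (mat_power B (Suc (Suc (Suc k)))) = pad (S * R)"
    using R S pad_mat_power [OF A(1)] pad_mat_power [OF B(1)]
    by (simp_all only: pad_mult carrier_matD pR pS a_def b_def)
  then have "mat_power A (Suc (Suc (Suc k))) = R * S" "mat_power B (Suc (Suc (Suc k))) = S * R"
    using carrier_matD [OF R] carrier_matD [OF S] carrier_matD [OF mat_power_carrier [OF A(1)]]
      carrier_matD [OF mat_power_carrier [OF B(1)]]
    by (auto intro!: pad_eqI simp del: mat_power.simps)
  moreover have "pad (A * R) = pad (R * B)" "pad (S * A) = pad (B * S)"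
    using R S A B arg_cong [OF *(3), of "\<lambda>x. a * x"] arg_cong [OF *(4), of "\<lambda>x. x * a"]
    by (simp_all add: pad_mult pR pS a_def [symmetric] b_def [symmetric] mult.assoc)
  then have "A * R = R * B" "S * A = B * S"
    using carrier_matD [OF R] carrier_matD [OF S] carrier_matD [OF A(1)] carrier_matD [OF B(1)]
    by (auto intro!: pad_eqI)
  ultimately show "shift_equivalent A B"
    unfolding shift_equivalent_def using A B R S zero_less_Suc by blast
qed

section \<open>Strong shift equivalence in prescribed sizes\<close>

lemma elementary_truncate:
  fixes r s :: "'r::{ring, monoid_mult} fmat"
  assumes "0 < m" "0 < n" "\<And>i j. m \<le> i \<or> n \<le> j \<Longrightarrow> ent r i j = 0"
    "\<And>i j. n \<le> i \<or> m \<le> j \<Longrightarrow> ent s i j = 0"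
  shows "elementary_strong_shift_equivalent (truncate m m (r * s)) (truncate n n (s * r))"
proof -
  define R where "R = truncate m n r"
  define S where "S = truncate n m s"
  have RS: "R \<in> carrier_mat m n" "S \<in> carrier_mat n m" "pad R = r" "pad S = s"
    using assms by (auto simp: R_def S_def truncate_carrier pad_truncate)
  have "truncate m m (r * s) = R * S" "truncate n n (s * r) = S * R"
    using carrier_matD [OF RS(1)] carrier_matD [OF RS(2)] truncate_pad [of "R * S" m m]
      truncate_pad [of "S * R" n n] RS
    by (simp_all add: pad_mult)
  with RS assms(1,2) show ?thesis
    unfolding elementary_strong_shift_equivalent_def by blast
qed

lemma elementary_truncate_truncate:
  fixes a :: "'r::{ring, monoid_mult} fmat"
  assumes "0 < m" "0 < n" "bounded_by m a" "bounded_by n a"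
  shows "elementary_strong_shift_equivalent (truncate m m a) (truncate n n a)"
proof -
  have b: "bounded_by (min m n) a"
    using assms by (simp add: min_def)
  have "elementary_strong_shift_equivalent (truncate m m (a * idm (min m n)))
      (truncate n n (idm (min m n) * a))"
    using assms by (intro elementary_truncate) (auto dest: bounded_byD simp: ent_idm)
  then show ?thesis using b by (simp add: idm_units)
qed

text \<open>The intermediate elements of a chain have no size of their own; each gets one large
  enough for its factors, and a change of size is itself an elementary step. This also turns the
  empty chain into a chain of length one.\<close>

lemma sse_strong_shift_equivalent:
  fixes a b :: "'r::{ring, monoid_mult} fmat"
  assumes "sse a b"
  shows "0 < m \<Longrightarrow> bounded_by m a \<Longrightarrow> 0 < n \<Longrightarrow> bounded_by n b \<Longrightarrow>
    strong_shift_equivalent (truncate m m a) (truncate n n b)"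
  using assms
proof (induction arbitrary: n)
  case base
  then show ?case
    unfolding strong_shift_equivalent_def
    by (intro tranclp.r_into_trancl elementary_truncate_truncate)
next
  case (step b c)
  then obtain r s where rs: "b = r * s" "c = s * r" by (auto simp: esse_def)
  obtain k where k: "bounded_by k r" "bounded_by k s" "bounded_by k c"
    using bounded_by_ex3 by blast
  \<comment> \<open>The successor makes the size positive, as empty matrices are excluded.\<close>
  define N where "N = Suc k"
  have N: "bounded_by N r" "bounded_by N s" "bounded_by N c" "0 < N"
    using k by (auto simp: N_def intro: bounded_by_mono)
  have "strong_shift_equivalent (truncate m m a) (truncate N N b)"
    using step N rs by (simp add: bounded_by_mult)
  moreover have "elementary_strong_shift_equivalent (truncate N N b) (truncate N N c)"
    unfolding rs using N by (intro elementary_truncate) (auto dest: bounded_byD)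
  moreover have "elementary_strong_shift_equivalent (truncate N N c) (truncate n n c)"
    using step.prems N by (intro elementary_truncate_truncate)
  ultimately show ?case
    unfolding strong_shift_equivalent_def by (meson tranclp.trancl_into_trancl)
qed

lemma strong_shift_equivalent_iff_sse:
  fixes A B :: "'r::{ring, monoid_mult} mat"
  assumes A: "A \<in> carrier_mat m m" "0 < m" and B: "B \<in> carrier_mat n n" "0 < n"
  shows "strong_shift_equivalent A B \<longleftrightarrow> sse (pad A) (pad B)"
proof
  have step: "esse (pad A) (pad B)" if "elementary_strong_shift_equivalent A B" for A B :: "'r mat"
    using that unfolding elementary_strong_shift_equivalent_def esse_def
    by (metis carrier_matD pad_mult)
  assume "strong_shift_equivalent A B"
  then show "sse (pad A) (pad B)"
    unfolding strong_shift_equivalent_def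
  proof (induction rule: tranclp_induct)
    case (base y)
    then show ?case using step by blast
  next
    case (step y z)
    then show ?case
      using \<open>\<And>B A. elementary_strong_shift_equivalent A B \<Longrightarrow> esse (pad A) (pad B)\<close>
      by (meson rtranclp.rtrancl_into_rtrancl)
  qed
next
  assume "sse (pad A) (pad B)"
  then show "strong_shift_equivalent A B"
    using sse_strong_shift_equivalent [of "pad A" "pad B" m n] A B
    by (simp add: bounded_by_pad truncate_pad)
qed

section \<open>The groups of stable classes\<close>

text \<open>The matrix \<open>A - 1\<close>. Stabilization only appends ones to the diagonal, so
  this is a complete invariant of the stable class of a square matrix.\<close>

definition res :: "'r::{ring, monoid_mult} mat \<Rightarrow> 'r fmat"
  where "res A = pad A - idm (dim_row A)"

lemma res_mult:
  assumes "A \<in> carrier_mat n n" "B \<in> carrier_mat n n"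
  shows "res (A * B) = circ (res A) (res B)"
  using assms
  by (simp add: res_def circ_def pad_mult algebra_simps idm_pad idm_units bounded_by_idm)

lemma res_one: "res (1\<^sub>m n) = 0"
  by (simp add: res_def pad_one)

lemma bounded_by_res: "A \<in> carrier_mat n n \<Longrightarrow> bounded_by n (res A)"
  by (auto simp: res_def bounded_by_pad bounded_by_diff bounded_by_idm)

lemma res_inject:
  "A \<in> carrier_mat n n \<Longrightarrow> B \<in> carrier_mat n n \<Longrightarrow> res A = res B \<Longrightarrow> A = B"
  by (rule pad_inject) (auto simp: res_def)

lemma res_truncate:
  assumes "bounded_by n u"
  shows "res (truncate n n (u + idm n)) = u"
proof -
  have "pad (truncate n n (u + idm n)) = u + idm n"
    using assms by (intro pad_truncate_square bounded_by_add bounded_by_idm)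
  then show ?thesis
    using truncate_carrier [of n n "u + idm n"] by (simp add: res_def)
qed

text \<open>A quasi-inverse of \<open>res A\<close> found among all finitely supported matrices
  already lives in the size of \<open>A\<close>.\<close>

lemma invertible_square_iff:
  "invertible_square A \<longleftrightarrow> square_mat A \<and> cinv (res A)"
proof
  assume "invertible_square A"
  then obtain n B where *: "A \<in> carrier_mat n n" "B \<in> carrier_mat n n" "A * B = 1\<^sub>m n" "B * A = 1\<^sub>m n"
    unfolding invertible_square_def by blast
  then have "circ (res A) (res B) = 0" "circ (res B) (res A) = 0"
    by (simp_all flip: res_mult add: res_one)
  with *(1) show "square_mat A \<and> cinv (res A)"
    unfolding cinv_def by auto
next
  assume A: "square_mat A \<and> cinv (res A)"
  define n where "n = dim_row A"
  have An: "A \<in> carrier_mat n n" using A by (auto simp: n_def)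
  obtain v where v: "circ (res A) v = 0" "circ v (res A) = 0"
    using A unfolding cinv_def by blast
  \<comment> \<open>The first equation bounds the rows of \<open>v\<close> by those of
    \<open>res A\<close>, the second one the columns.\<close>
  have e: "v = - res A - res A * v" "v = - res A - v * res A"
    using v by (simp_all add: circ_def algebra_simps eq_neg_iff_add_eq_0)
  have b: "bounded_by n (res A)" using An by (rule bounded_by_res)
  have "ent v i j = 0" if "n \<le> i" for i j
  proof -
    have "ent (res A * v) i j = 0"
      using b that by (subst ent_mult_on [where K = "{}"]) (auto simp: bounded_byD)
    then show ?thesis
      using b that by (subst e(1)) (simp add: ent_simps bounded_byD)
  qed
  moreover have "ent v i j = 0" if "n \<le> j" for i j
  proof -
    have "ent (v * res A) i j = 0"
      using b that by (subst ent_mult_on [where K = "{}"]) (auto simp: bounded_byD)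
    then show ?thesis
      using b that by (subst e(2)) (simp add: ent_simps bounded_byD)
  qed
  ultimately have bv: "bounded_by n v" unfolding bounded_by_def by blast
  define B where "B = truncate n n (v + idm n)"
  have B: "B \<in> carrier_mat n n" "res B = v"
    using bv by (simp_all add: B_def truncate_carrier res_truncate)
  have "res (A * B) = res (1\<^sub>m n)" "res (B * A) = res (1\<^sub>m n)"
    using An B v by (simp_all add: res_mult res_one)
  then have "A * B = 1\<^sub>m n" "B * A = 1\<^sub>m n"
    using An B by (auto intro!: res_inject [of _ n])
  then show "invertible_square A"
    unfolding invertible_square_def using An B by blast
qed

lemma res_stabilize:
  assumes "square_mat A"
  shows "res (stabilize k A) = res A"
  using assms by (intro fmat_eqI) (auto simp: res_def ent_diff ent_pad ent_idm stabilize_def)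

lemma stably_equal_iff:
  "(A, B) \<in> stably_equal \<longleftrightarrow> invertible_square A \<and> invertible_square B \<and> res A = res B"
proof -
  have "\<exists>k l. stabilize k A = stabilize l B"
    if "square_mat A" "square_mat B" "res A = res B" for A B :: "'a mat"
  proof (intro exI)
    have "stabilize (dim_row B) A \<in> carrier_mat (dim_row A + dim_row B) (dim_row A + dim_row B)"
      "stabilize (dim_row A) B \<in> carrier_mat (dim_row A + dim_row B) (dim_row A + dim_row B)"
      using that(1,2) by (auto simp: stabilize_def)
    then show "stabilize (dim_row B) A = stabilize (dim_row A) B"
      by (rule res_inject) (simp only: res_stabilize [OF that(1)] res_stabilize [OF that(2)] that(3))
  qed
  moreover have "res A = res B"
    if "square_mat A" "square_mat B" "stabilize k A = stabilize l B" for A B :: "'a mat" and k l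
    using res_stabilize [OF that(1), of k] res_stabilize [OF that(2), of l] that(3) by simp
  ultimately show ?thesis
    unfolding stably_equal_def mem_Collect_eq prod.case invertible_square_iff by blast
qed

text \<open>Empty unless \<open>cinv u\<close>, so distinct \<open>u\<close> are told apart only
  under invertibility.\<close>

definition gl_class :: "'r::{ring, monoid_mult} fmat \<Rightarrow> 'r mat set"
  where "gl_class u = {A. invertible_square A \<and> res A = u}"

lemma stable_class_eq: "invertible_square A \<Longrightarrow> stable_class A = gl_class (res A)"
  by (auto simp: stable_class_def gl_class_def stably_equal_iff)

lemma ex_representative:
  assumes "cinv u" "bounded_by n u"
  shows "\<exists>A \<in> carrier_mat n n. A \<in> gl_class u"
  using assms truncate_carrier [of n n "u + idm n"]
  by (intro bexI [of _ "truncate n n (u + idm n)"])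
    (auto simp: gl_class_def invertible_square_iff res_truncate)

lemma gl_class_inject:
  assumes "cinv u" "gl_class u = gl_class v"
  shows "u = v"
proof -
  obtain n where "bounded_by n u" using bounded_by_ex by blast
  then obtain A where "A \<in> gl_class u" using ex_representative assms by blast
  then show ?thesis using assms(2) by (auto simp: gl_class_def)
qed

lemma carrier_GL: "carrier (GL TYPE('r::{ring, monoid_mult})) = gl_class ` Collect cinv"
proof -
  have 1: "stably_equal `` {A} = gl_class (res A)" if "invertible_square A" for A :: "'r mat"
    using stable_class_eq [OF that] by (simp add: stable_class_def)
  have 2: "\<exists>A. invertible_square A \<and> res A = u" if "cinv u" for u :: "'r fmat"
    using ex_representative [OF that] bounded_by_ex [of u] by (auto simp: gl_class_def)
  have "Collect invertible_square // stably_equal = gl_class ` Collect (cinv :: 'r fmat \<Rightarrow> _)"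
  proof
    show "Collect invertible_square // stably_equal \<subseteq> gl_class ` Collect (cinv :: 'r fmat \<Rightarrow> _)"
      by (auto simp: quotient_def 1) (simp add: invertible_square_iff)
    show "gl_class ` Collect (cinv :: 'r fmat \<Rightarrow> _) \<subseteq> Collect invertible_square // stably_equal"
    proof
      fix x :: "'r mat set" assume "x \<in> gl_class ` Collect cinv"
      then obtain A where "invertible_square A" "x = gl_class (res A)" using 2 by auto
      then show "x \<in> Collect invertible_square // stably_equal"
        by (auto simp: 1 intro!: quotientI simp flip: 1)
    qed
  qed
  then show ?thesis by (simp add: GL_def)
qed

text \<open>The union in the product of \<open>GL\<close> runs over one set only: all products of
  representatives have the same \<open>res\<close>, and representatives of a common size
  exist.\<close>

lemma mult_GL:
  fixes u v :: "'r::{ring, monoid_mult} fmat"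
  assumes "cinv u" "cinv v"
  shows "gl_class u \<otimes>\<^bsub>GL TYPE('r)\<^esub> gl_class v = gl_class (circ u v)"
proof -
  have *: "stable_class (A * B) = gl_class (circ u v)"
    if "A \<in> gl_class u" "B \<in> gl_class v" "dim_row A = dim_row B" for A B
  proof -
    define n where "n = dim_row A"
    have AB: "A \<in> carrier_mat n n" "B \<in> carrier_mat n n"
      using that by (auto simp: gl_class_def invertible_square_iff n_def)
    have r: "res (A * B) = circ u v" "square_mat (A * B)"
      using that AB by (simp_all add: res_mult [OF AB] gl_class_def)
    then have "invertible_square (A * B)"
      using cinv_circ [OF assms] unfolding invertible_square_iff by simp
    then show ?thesis
      by (simp only: stable_class_eq r)
  qed
  obtain n where n: "bounded_by n u" "bounded_by n v" using bounded_by_ex2 by blast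
  obtain A B where AB: "A \<in> carrier_mat n n" "A \<in> gl_class u" "B \<in> carrier_mat n n" "B \<in> gl_class v"
    using ex_representative assms n by blast
  then have "{stable_class (A * B) |A B. A \<in> gl_class u \<and> B \<in> gl_class v \<and> dim_row A = dim_row B}
      = {gl_class (circ u v)}"
    using * by (auto simp: set_eq_iff) (metis carrier_matD(1))
  then show ?thesis by (simp add: GL_def)
qed

lemma one_GL: "\<one>\<^bsub>GL TYPE('r::{ring, monoid_mult})\<^esub> = gl_class 0"
proof -
  have "invertible_square (1\<^sub>m 1 :: 'r mat)"
    by (simp add: invertible_square_iff res_one cinv_def) (metis circ_zero(1))
  then show ?thesis
    by (simp add: GL_def stable_class_eq res_one)
qed

lemma cinv_zero: "cinv 0"
  unfolding cinv_def by (metis circ_zero(1))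

lemma group_GL: "group (GL TYPE('r::{ring, monoid_mult}))"
proof (rule groupI)
  fix x y z assume "x \<in> carrier (GL TYPE('r))" "y \<in> carrier (GL TYPE('r))" "z \<in> carrier (GL TYPE('r))"
  then show "x \<otimes>\<^bsub>GL TYPE('r)\<^esub> y \<otimes>\<^bsub>GL TYPE('r)\<^esub> z = x \<otimes>\<^bsub>GL TYPE('r)\<^esub> (y \<otimes>\<^bsub>GL TYPE('r)\<^esub> z)"
    by (auto simp: carrier_GL mult_GL cinv_circ circ_assoc)
next
  fix x assume "x \<in> carrier (GL TYPE('r))"
  then obtain u :: "'r fmat" where u: "x = gl_class u" "cinv u" by (auto simp: carrier_GL)
  then obtain v where v: "circ v u = 0" "cinv v" unfolding cinv_def by blast
  then show "\<exists>y\<in>carrier (GL TYPE('r)). y \<otimes>\<^bsub>GL TYPE('r)\<^esub> x = \<one>\<^bsub>GL TYPE('r)\<^esub>"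
    using u by (intro bexI [of _ "gl_class v"]) (auto simp: carrier_GL mult_GL one_GL)
qed (auto simp: carrier_GL mult_GL one_GL cinv_circ cinv_zero circ_zero)

lemma res_elementary:
  assumes "elementary_matrix E"
  shows "res E \<in> elc"
proof -
  obtain i j where ij: "i \<noteq> j" and sq: "square_mat E" and
    E: "\<And>k l. k < dim_row E \<Longrightarrow> l < dim_row E \<Longrightarrow> (k, l) \<noteq> (i, j) \<Longrightarrow> E $$ (k, l) = 1\<^sub>m (dim_row E) $$ (k, l)"
    using assms unfolding elementary_matrix_def by blast
  \<comment> \<open>If \<open>(i, j)\<close> lies outside the matrix, \<open>E\<close> is the
    identity and both sides are zero.\<close>
  have "res E = sg i j (ent (res E) i j)"
    by (rule fmat_eqI) (use sq E ij in \<open>auto simp: res_def ent_diff ent_pad ent_idm ent_sg\<close>)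
  then show ?thesis using ij sg_elc by metis
qed

lemma ex_elementary:
  fixes x :: "'r::{ring, monoid_mult}"
  assumes "i \<noteq> j"
  shows "\<exists>E. elementary_matrix E \<and> res E = sg i j x"
proof -
  define n where "n = Suc (max i j)"
  define E where "E = truncate n n (sg i j x + idm n)"
  have "elementary_matrix E"
    unfolding elementary_matrix_def
  proof (intro conjI exI)
    show "\<forall>k<dim_row E. \<forall>l<dim_row E. (k, l) \<noteq> (i, j) \<longrightarrow> E $$ (k, l) = 1\<^sub>m (dim_row E) $$ (k, l)"
      by (auto simp: E_def truncate_def ent_add ent_sg ent_idm)
  qed (simp_all add: assms E_def truncate_def)
  moreover have "res E = sg i j x"
    unfolding E_def by (rule res_truncate) (simp add: n_def bounded_by_sg)
  ultimately show ?thesis by blast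
qed

lemma stable_class_elementary:
  "elementary_matrix E \<Longrightarrow> stable_class E = gl_class (res E)"
  unfolding elementary_matrix_def [of E] using elc_cinv [OF res_elementary [of E]]
  by (intro stable_class_eq) (simp add: invertible_square_iff elementary_matrix_def)

lemma El_eq: "El TYPE('r::{ring, monoid_mult}) = gl_class ` elc"
proof
  interpret group "GL TYPE('r)" by (rule group_GL)
  show "El TYPE('r) \<subseteq> gl_class ` elc"
  proof
    fix x assume "x \<in> El TYPE('r)"
    then have "x \<in> generate (GL TYPE('r)) (stable_class ` Collect elementary_matrix)"
      by (simp add: El_def)
    then show "x \<in> gl_class ` elc"
    proof (induction rule: generate.induct)
      case one
      then show ?case by (auto simp: one_GL elc.zero)
    next
      case (incl h)
      then show ?case by (auto simp: stable_class_elementary res_elementary)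
    next
      case (inv h)
      then obtain u :: "'r fmat" where u: "h = gl_class u" "u \<in> elc"
        by (auto simp: stable_class_elementary res_elementary)
      then obtain v where v: "v \<in> elc" "circ v u = 0" using elc_inverse by blast
      then have "inv\<^bsub>GL TYPE('r)\<^esub> h = gl_class v"
        using u elc_cinv by (intro inv_equality) (auto simp: mult_GL one_GL carrier_GL)
      then show ?case using v by simp
    next
      case (eng h1 h2)
      then show ?case by (auto simp: mult_GL elc_cinv elc_circ)
    qed
  qed
  show "gl_class ` elc \<subseteq> El TYPE('r)"
  proof
    fix x :: "'r mat set" assume "x \<in> gl_class ` elc"
    then obtain u where u: "u \<in> elc" "x = gl_class u" by blast
    from u(1) have "gl_class u \<in> El TYPE('r)"
    proof (induction u rule: elc.induct)
      case zero
      then show ?case by (simp add: El_def generate.one flip: one_GL)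
    next
      case (step u i j x)
      obtain E where E: "elementary_matrix E" "res E = sg i j x"
        using ex_elementary step by blast
      then have "gl_class (sg i j x) \<in> El TYPE('r)"
        unfolding El_def using stable_class_elementary [OF E(1)] by (intro generate.incl) auto
      then have "gl_class u \<otimes>\<^bsub>GL TYPE('r)\<^esub> gl_class (sg i j x) \<in> El TYPE('r)"
        using step.IH unfolding El_def by (rule generate.eng [rotated])
      then show ?case
        using step by (simp add: mult_GL elc_cinv sg_elc)
    qed
    then show "x \<in> El TYPE('r)" by (simp add: u)
  qed
qed

section \<open>Cosets of the elementary subgroup and the kernel \<open>NK1\<close>\<close>

definition el_coset :: "'r::{ring, monoid_mult} fmat \<Rightarrow> 'r mat set set"
  where "el_coset u = (\<lambda>e. gl_class (circ e u)) ` elc"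

lemma r_coset_El:
  fixes u :: "'r::{ring, monoid_mult} fmat"
  assumes "cinv u"
  shows "El TYPE('r) #>\<^bsub>GL TYPE('r)\<^esub> gl_class u = el_coset u"
  using assms by (auto simp: r_coset_def El_eq mult_GL elc_cinv el_coset_def)

lemma carrier_K1: "carrier (K1 TYPE('r::{ring, monoid_mult})) = el_coset ` Collect cinv"
  unfolding K1_def FactGroup_def RCOSETS_def carrier_GL
  by (auto simp: r_coset_El)

lemma one_K1: "\<one>\<^bsub>K1 TYPE('r::{ring, monoid_mult})\<^esub> = El TYPE('r)"
  by (simp add: K1_def FactGroup_def)

lemma el_coset_eq_El_iff:
  fixes u :: "'r::{ring, monoid_mult} fmat"
  assumes "cinv u"
  shows "el_coset u = El TYPE('r) \<longleftrightarrow> u \<in> elc"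
proof
  assume "el_coset u = El TYPE('r)"
  moreover have "gl_class u \<in> el_coset u"
    unfolding el_coset_def by (rule image_eqI [OF _ elc.zero]) (simp add: circ_zero)
  ultimately obtain e :: "'r fmat" where "e \<in> elc" "gl_class u = gl_class e"
    by (auto simp: El_eq)
  then show "u \<in> elc" using gl_class_inject [OF assms] by metis
next
  assume u: "u \<in> elc"
  then obtain v where v: "v \<in> elc" "circ v u = 0" using elc_inverse by blast
  have "gl_class e \<in> el_coset u" if "e \<in> elc" for e
    unfolding el_coset_def
    by (rule image_eqI [of _ _ "circ e v"]) (use that v in \<open>simp_all add: circ_assoc circ_zero elc_circ\<close>)
  then show "el_coset u = El TYPE('r)"
    using u by (auto simp: El_eq el_coset_def elc_circ)
qed

lemma cf_0_cinv: "cinv u \<Longrightarrow> cinv (cf 0 u)"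
  unfolding cinv_def by (metis cf_0_circ cf_zero)

lemma res_map_mat:
  fixes A :: "'r::{ring, monoid_mult} npoly mat"
  shows "res (map_mat npoly_at_0 A) = cf 0 (res A)"
  by (rule fmat_eqI) (auto simp: res_def ent_cf ent_diff ent_pad ent_idm cf_diff cf_idm
      npoly_at_0_def npoly_coeff_zero)

lemma GL_map_at_0:
  fixes u :: "'r::{ring, monoid_mult} npoly fmat"
  assumes "cinv u"
  shows "GL_map npoly_at_0 (gl_class u) = gl_class (cf 0 u)"
proof -
  have *: "stable_class (map_mat npoly_at_0 A) = gl_class (cf 0 u)" if "A \<in> gl_class u" for A
    using that by (subst stable_class_eq)
      (auto simp: gl_class_def invertible_square_iff res_map_mat cf_0_cinv)
  obtain n where "bounded_by n u" using bounded_by_ex by blast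
  then obtain A where "A \<in> gl_class u" using ex_representative assms by blast
  then show ?thesis
    unfolding GL_map_def using * by auto
qed

lemma K1_map_at_0:
  fixes u :: "'r::{ring, monoid_mult} npoly fmat"
  assumes "cinv u"
  shows "K1_map npoly_at_0 (el_coset u) = (\<Union>e\<in>elc. el_coset (cf 0 (circ e u)) :: 'r mat set set)"
  using assms unfolding K1_map_def el_coset_def [of u]
  by (auto simp: GL_map_at_0 cinv_circ elc_cinv r_coset_El cf_0_cinv)

text \<open>Elementary matrices stay elementary at \<open>t = 0\<close>, so if \<open>cf 0 u\<close>
  is elementary, every coset in the union is \<open>El\<close>. Conversely, the member for
  \<open>e = 0\<close> contains the class of \<open>cf 0 u\<close>.\<close>

lemma K1_map_at_0_eq_El_iff:
  fixes u :: "'r::{ring, monoid_mult} npoly fmat"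
  assumes "cinv u"
  shows "K1_map npoly_at_0 (el_coset u) = El TYPE('r) \<longleftrightarrow> cf 0 u \<in> elc"
proof
  assume *: "K1_map npoly_at_0 (el_coset u) = El TYPE('r)"
  have "gl_class (cf 0 u) \<in> el_coset (cf 0 (circ 0 u))"
    unfolding el_coset_def by (rule image_eqI [OF _ elc.zero]) (simp add: circ_zero)
  then have "gl_class (cf 0 u) \<in> El TYPE('r)"
    unfolding * [symmetric] K1_map_at_0 [OF assms] using elc.zero by blast
  then obtain e :: "'r fmat" where "e \<in> elc" "gl_class (cf 0 u) = gl_class e"
    by (auto simp: El_eq)
  then show "cf 0 u \<in> elc" using gl_class_inject [OF cf_0_cinv [OF assms]] by metis
next
  assume u: "cf 0 u \<in> elc"
  have "el_coset (cf 0 (circ e u)) = El TYPE('r)" if "e \<in> elc" for e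
  proof -
    have "cf 0 (circ e u) \<in> elc"
      using that u by (simp add: cf_0_circ elc_circ cf_0_elc)
    then show ?thesis using el_coset_eq_El_iff elc_cinv by blast
  qed
  then show "K1_map npoly_at_0 (el_coset u) = El TYPE('r)"
    unfolding K1_map_at_0 [OF assms] using elc.zero by auto
qed

text \<open>\<open>trivial_group\<close> also asks for the group axioms. Once the carrier is the
  single coset \<open>El\<close>, they reduce to \<open>El\<close> times \<open>El\<close> being
  \<open>El\<close>, and what remains is a statement about the carrier.\<close>

lemma trivial_NK1_iff:
  "trivial_group (NK1 TYPE('r::{ring, monoid_mult})) \<longleftrightarrow>
    (\<forall>u :: 'r npoly fmat. cinv u \<longrightarrow> cf 0 u \<in> elc \<longrightarrow> u \<in> elc)"
proof -
  define K where "K = carrier (NK1 TYPE('r))"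
  have "K = {x \<in> el_coset ` Collect cinv. K1_map npoly_at_0 x = El TYPE('r)}"
    by (simp add: K_def NK1_def kernel_def carrier_K1 one_K1)
  also have "\<dots> = el_coset ` {u. cinv u \<and> K1_map npoly_at_0 (el_coset u) = El TYPE('r)}"
    by blast
  also have "\<dots> = el_coset ` {u :: 'r npoly fmat. cinv u \<and> cf 0 u \<in> elc}"
    by (intro arg_cong [of _ _ "image el_coset"] Collect_cong conj_cong refl K1_map_at_0_eq_El_iff)
  finally have K: "K = el_coset ` {u :: 'r npoly fmat. cinv u \<and> cf 0 u \<in> elc}" .
  have one: "\<one>\<^bsub>NK1 TYPE('r)\<^esub> = El TYPE('r npoly)"
    by (simp add: NK1_def one_K1)
  have mult: "El TYPE('r npoly) \<otimes>\<^bsub>NK1 TYPE('r)\<^esub> El TYPE('r npoly) = El TYPE('r npoly)"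
  proof -
    have "El TYPE('r npoly) <#>\<^bsub>GL TYPE('r npoly)\<^esub> El TYPE('r npoly) = El TYPE('r npoly)"
    proof
      show "El TYPE('r npoly) <#>\<^bsub>GL TYPE('r npoly)\<^esub> El TYPE('r npoly) \<subseteq> El TYPE('r npoly)"
        by (auto simp: set_mult_def El_eq mult_GL elc_cinv elc_circ)
      show "El TYPE('r npoly) \<subseteq> El TYPE('r npoly) <#>\<^bsub>GL TYPE('r npoly)\<^esub> El TYPE('r npoly)"
      proof
        fix x assume "x \<in> El TYPE('r npoly)"
        then obtain u :: "'r npoly fmat" where u: "x = gl_class u" "u \<in> elc" by (auto simp: El_eq)
        then have "x = gl_class 0 \<otimes>\<^bsub>GL TYPE('r npoly)\<^esub> gl_class u"
          by (simp add: mult_GL cinv_zero elc_cinv circ_zero)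
        then show "x \<in> El TYPE('r npoly) <#>\<^bsub>GL TYPE('r npoly)\<^esub> El TYPE('r npoly)"
          using u elc.zero by (auto simp: set_mult_def El_eq)
      qed
    qed
    then show ?thesis by (simp add: NK1_def K1_def FactGroup_def)
  qed
  have "group (NK1 TYPE('r))" if "K = {El TYPE('r npoly)}"
    by (rule groupI) (use that in \<open>auto simp: K_def one mult\<close>)
  then have "trivial_group (NK1 TYPE('r)) \<longleftrightarrow> K = {El TYPE('r npoly)}"
    unfolding trivial_group_def K_def [symmetric] one by blast
  also have "\<dots> \<longleftrightarrow> (\<forall>u :: 'r npoly fmat. cinv u \<longrightarrow> cf 0 u \<in> elc \<longrightarrow> u \<in> elc)"
  proof
    assume *: "K = {El TYPE('r npoly)}"
    show "\<forall>u :: 'r npoly fmat. cinv u \<longrightarrow> cf 0 u \<in> elc \<longrightarrow> u \<in> elc"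
    proof (intro allI impI)
      fix u :: "'r npoly fmat" assume u: "cinv u" "cf 0 u \<in> elc"
      then have "el_coset u \<in> K" unfolding K by blast
      then show "u \<in> elc" using * u el_coset_eq_El_iff by blast
    qed
  next
    assume *: "\<forall>u :: 'r npoly fmat. cinv u \<longrightarrow> cf 0 u \<in> elc \<longrightarrow> u \<in> elc"
    have "el_coset 0 = El TYPE('r npoly)" "el_coset 0 \<in> K"
      unfolding K using el_coset_eq_El_iff cinv_zero elc.zero by (auto simp: cf_zero)
    moreover have "el_coset u = El TYPE('r npoly)" if "cinv u" "cf 0 u \<in> elc" for u :: "'r npoly fmat"
      using that * el_coset_eq_El_iff by blast
    ultimately show "K = {El TYPE('r npoly)}"
      unfolding K by auto
  qed
  finally show ?thesis .
qed

theorem corollary6p4p2: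
  shows "trivial_group (NK1 TYPE('r::{ring, monoid_mult})) \<longleftrightarrow>
    (\<forall>m > 0. \<forall>n > 0. \<forall>A \<in> carrier_mat m m. \<forall>B \<in> carrier_mat n n.
       shift_equivalent A (B :: 'r mat) \<longleftrightarrow> strong_shift_equivalent A B)"
proof
  assume "trivial_group (NK1 TYPE('r))"
  then have NK: "cinv u \<Longrightarrow> cf 0 u \<in> elc \<Longrightarrow> u \<in> elc" for u :: "'r npoly fmat"
    by (simp add: trivial_NK1_iff)
  have "se a b \<longleftrightarrow> sse a b" for a b :: "'r fmat"
    using se_sse [OF NK] sse_se by blast
  then show "\<forall>m > 0. \<forall>n > 0. \<forall>A \<in> carrier_mat m m. \<forall>B \<in> carrier_mat n n.
       shift_equivalent A (B :: 'r mat) \<longleftrightarrow> strong_shift_equivalent A B"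
    by (simp add: shift_equivalent_iff_se strong_shift_equivalent_iff_sse)
next
  assume SE: "\<forall>m > 0. \<forall>n > 0. \<forall>A \<in> carrier_mat m m. \<forall>B \<in> carrier_mat n n.
       shift_equivalent A (B :: 'r mat) \<longleftrightarrow> strong_shift_equivalent A B"
  have linear: "- tau 1 N \<in> elc" if "cinv (- tau 1 N)" for N :: "'r fmat"
  proof -
    obtain k where k: "pw N k = 0"
      using cinv_nilpotent \<open>cinv (- tau 1 N)\<close> by blast
    obtain n where "bounded_by n N" using bounded_by_ex by blast
    \<comment> \<open>The successor guards against size zero; for the same reason the zero matrix
      \<open>Z\<close> below is 1 by 1.\<close>
    then have n: "bounded_by (Suc n) N" by (rule bounded_by_mono) simp
    define A where "A = truncate (Suc n) (Suc n) N"
    have A: "A \<in> carrier_mat (Suc n) (Suc n)" "pad A = N"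
      using n by (simp_all add: A_def truncate_carrier pad_truncate_square)
    define Z :: "'r mat" where "Z = 0\<^sub>m 1 1"
    have Z: "Z \<in> carrier_mat 1 1" "pad Z = 0"
      by (auto simp: Z_def intro!: fmat_eqI simp: ent_pad ent_zero)
    have "pw (0 :: 'r fmat) k = 0" by (induction k) auto
    \<comment> \<open>Nilpotency is shift equivalence to zero, with zero matrices as both maps and
      the vanishing power as lag.\<close>
    then have "se N 0"
      unfolding se_def using k by (intro exI [of _ 0] exI [of _ k]) simp
    then have "shift_equivalent A Z"
      using A Z by (subst shift_equivalent_iff_se) auto
    then have "strong_shift_equivalent A Z"
      using SE A(1) Z(1) by auto
    then have "sse N 0"
      using A Z by (subst (asm) strong_shift_equivalent_iff_sse) auto
    then show ?thesis
      using sse_elc [OF sse_sym, of N 0] by (simp add: tau_zero elc.zero)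
  qed
  show "trivial_group (NK1 TYPE('r))"
    unfolding trivial_NK1_iff
  proof (intro allI impI)
    fix u :: "'r npoly fmat" assume u: "cinv u" "cf 0 u \<in> elc"
    obtain e where e: "e \<in> elc" "circ (cf 0 u) e = 0" "circ e (cf 0 u) = 0"
      using elc_inverse u(2) by blast
    \<comment> \<open>Dividing by the constant coefficient, which is elementary, makes
      \<open>v\<close> vanish at \<open>t = 0\<close>, as linearization requires.\<close>
    define v where "v = circ (tau 0 e) u"
    have "cinv v"
      unfolding v_def by (rule cinv_circ [OF elc_cinv [OF tau_0_elc [OF e(1)]] u(1)])
    moreover have "cf 0 v = 0" by (simp add: v_def cf_0_circ cf_tau e)
    moreover obtain d where "\<And>k. d \<le> k \<Longrightarrow> cf k v = 0" using cf_bound by blast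
    then have "\<And>k. Suc d < k \<Longrightarrow> cf k v = 0" by simp
    ultimately have "v \<in> elc" using cinv_linearize [OF linear] by blast
    then have "circ (tau 0 (cf 0 u)) v \<in> elc"
      using u(2) by (intro elc_circ tau_0_elc)
    moreover have "u = circ (tau 0 (cf 0 u)) v"
    proof -
      have "circ (tau 0 (cf 0 u)) (tau 0 e) = tau 0 (circ (cf 0 u) e)"
        by (simp add: circ_def tau_add tau_mult)
      then show ?thesis by (simp add: v_def e tau_zero circ_zero flip: circ_assoc)
    qed
    ultimately show "u \<in> elc" by metis
  qed
qed

end
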